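(* Let $\mathbb{F}$ be a finite field and $d\ge0$ an integer. Consider the Polynomial Extrapolation problem: given $q$ quantum queries to the restriction to $\mathbb{F}\setminus\{0\}$ of a polynomial $A$ drawn uniformly at random from the polynomials over $\mathbb{F}$ of degree at most $d$, output $A(0)$. The maximum success probability of any $q$-query quantum algorithm for this problem is: (1) exactly $\frac{1}{|\mathbb{F}|}$ if $q\le d/2$; (2) at most $\lfloor(|\mathbb{F}|-1)/q\rfloor/|\mathbb{F}|$ if $q=(d+1)/2$, and equal to this value if moreover $q$ divides $|\mathbb{F}|-1$; (3) at least $1-\frac{(d/2+1)!+d+1}{|\mathbb{F}|}$ if $q\ge(d+2)/2$.
   Context: A quantum query is the unitary $|x,y,z\rangle\mapsto|x,y+A(x),z\rangle$ for $x\in\mathbb{F}\setminus\{0\}$, $y\in\mathbb{F}$; queries may be adaptive. Success probability is averaged over the uniformly random $A$.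
   Formalization: In (2) the upper bound is stated only for q ≤ |F|−1; for larger q the floor is 0 and the claimed bound 0 is false, since guessing succeeds with probability 1/|F|. In (3), (d/2+1)! is read as (⌊d/2⌋+1)! for odd d, which is the stronger reading. *)

theory Defs
  imports "HOL-Analysis.Analysis" "HOL-Computational_Algebra.Polynomial"
begin

text \<open>
  A computational basis vector $|x,y,z\rangle$ is a triple in \<open>basis w\<close>, where \<open>w\<close> is the dimension
  of the workspace. Vectors and operators on the Hilbert space spanned by \<open>basis w\<close> are given by
  their coefficients, and the coefficients at indices outside \<open>basis w\<close> are irrelevant:
  every sum below ranges over \<open>basis w\<close> only.
\<close>

type_synonym 'f index = "'f \<times> 'f \<times> nat"
type_synonym 'f state = "'f index \<Rightarrow> complex"
type_synonym 'f operator = "'f index \<Rightarrow> 'f index \<Rightarrow> complex"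

definition basis :: "nat \<Rightarrow> ('f::zero) index set" where
  "basis w = (UNIV - {0}) \<times> UNIV \<times> {..<w}"

definition unit_state :: "nat \<Rightarrow> ('f::zero) state \<Rightarrow> bool" where
  "unit_state w \<psi> \<longleftrightarrow> (\<Sum>i\<in>basis w. (cmod (\<psi> i))\<^sup>2) = 1"

definition apply_op :: "nat \<Rightarrow> ('f::zero) operator \<Rightarrow> 'f state \<Rightarrow> 'f state" where
  "apply_op w M \<psi> = (\<lambda>i. \<Sum>j\<in>basis w. M i j * \<psi> j)"

text \<open>\<open>form w M \<psi>\<close> is $\langle\psi|M|\psi\rangle$.\<close>

definition form :: "nat \<Rightarrow> ('f::zero) operator \<Rightarrow> 'f state \<Rightarrow> complex" where
  "form w M \<psi> = (\<Sum>i\<in>basis w. cnj (\<psi> i) * apply_op w M \<psi> i)"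

definition unitary_op :: "nat \<Rightarrow> ('f::zero) operator \<Rightarrow> bool" where
  "unitary_op w U \<longleftrightarrow>
    (\<forall>i\<in>basis w. \<forall>j\<in>basis w.
       (\<Sum>k\<in>basis w. cnj (U k i) * U k j) = (if i = j then 1 else 0) \<and>
       (\<Sum>k\<in>basis w. U i k * cnj (U j k)) = (if i = j then 1 else 0))"

definition povm :: "nat \<Rightarrow> ('f::{zero,finite} \<Rightarrow> 'f operator) \<Rightarrow> bool" where
  "povm w E \<longleftrightarrow>
    (\<forall>a \<psi>. form w (E a) \<psi> \<in> \<real>\<^sub>\<ge>\<^sub>0) \<and>
    (\<forall>i\<in>basis w. \<forall>j\<in>basis w. (\<Sum>a\<in>UNIV. E a i j) = (if i = j then 1 else 0))"

text \<open>The matrix of the query $|x,y,z\rangle\mapsto|x,y+A(x),z\rangle$: the row is the target.\<close>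

definition query_op :: "('f::field) poly \<Rightarrow> 'f operator" where
  "query_op A = (\<lambda>i (x, y, z). if i = (x, y + poly A x, z) then 1 else 0)"

text \<open>
  The list \<open>gates\<close> holds one input-independent unitary for each query, applied right after it.
  A unitary preceding the first query is absorbed in the initial state, which is arbitrary.
  The final measurement has one outcome for each possible answer.
\<close>

record 'f query_algorithm =
  workdim :: nat
  init :: "'f state"
  gates :: "'f operator list"
  meas :: "'f \<Rightarrow> 'f operator"

definition is_query_algorithm :: "nat \<Rightarrow> ('f::{field,finite}) query_algorithm \<Rightarrow> bool" where
  "is_query_algorithm q alg \<longleftrightarrow>
    length (gates alg) = q \<and>
    unit_state (workdim alg) (init alg) \<and>
    (\<forall>U\<in>set (gates alg). unitary_op (workdim alg) U) \<and>
    povm (workdim alg) (meas alg)"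

definition final_state :: "('f::field) query_algorithm \<Rightarrow> 'f poly \<Rightarrow> 'f state" where
  "final_state alg A =
    foldl (\<lambda>\<psi> U. apply_op (workdim alg) U (apply_op (workdim alg) (query_op A) \<psi>))
      (init alg) (gates alg)"

definition outcome_prob :: "('f::field) query_algorithm \<Rightarrow> 'f poly \<Rightarrow> 'f \<Rightarrow> real" where
  "outcome_prob alg A a = Re (form (workdim alg) (meas alg a) (final_state alg A))"

definition success_prob :: "nat \<Rightarrow> ('f::{field,finite}) query_algorithm \<Rightarrow> real" where
  "success_prob d alg =
    (\<Sum>A | degree A \<le> d. outcome_prob alg A (poly A 0)) / real (card {A :: 'f poly. degree A \<le> d})"

definition is_max_success_prob :: "('f::{field,finite}) itself \<Rightarrow> nat \<Rightarrow> nat \<Rightarrow> real \<Rightarrow> bool" where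
  "is_max_success_prob _ d q p \<longleftrightarrow>
    (\<exists>alg :: 'f query_algorithm. is_query_algorithm q alg \<and> success_prob d alg = p) \<and>
    (\<forall>alg :: 'f query_algorithm. is_query_algorithm q alg \<longrightarrow> success_prob d alg \<le> p)"

end

theory Submission
  imports Defs
begin

text \<open>
  After a Fourier transform of the response register a query at \<open>x\<close> multiplies the amplitudes by
  characters \<open>A \<mapsto> e (s * A x)\<close>. So after \<open>q\<close> queries the state is a combination of the characters
  \<open>A \<mapsto> e (\<Sum>x. u x * A x)\<close> for weights \<open>u\<close> with at most \<open>q\<close> nonzero values, none of them at 0.
  Such a character only depends on the moments \<open>\<Sum>x. u x * x ^ k\<close>, \<open>k \<le> d\<close>, which pair with the
  coefficients of \<open>A\<close>. Averaging over the coefficients \<open>1..d\<close> decouples characters whose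
  moments \<open>1..d\<close> differ, and in a class with \<open>n\<close> values of the moment 0, Cauchy-Schwarz bounds the
  success probability by \<open>n / |F|\<close>. A uniform superposition over one class attains this bound,
  since it has to discriminate \<open>n\<close> characters of the additive group of the field. The optimal
  success probability is hence \<open>N / |F|\<close> for the largest class size \<open>N\<close>.

  The rest is counting. If \<open>2 * q \<le> d\<close>, a Vandermonde argument gives \<open>N = 1\<close>. If \<open>2 * q = d + 1\<close>, weights
  of one class have disjoint supports of size \<open>q\<close>, and the fibres of \<open>x \<mapsto> x ^ q\<close> show that equality
  can occur. For even \<open>d\<close> and \<open>q = d / 2 + 1\<close>, a second moment argument for the moment map on
  weights with exactly \<open>q\<close> nonzero values shows that almost all moment vectors are attained.
\<close>

section \<open>Moments of sparse weights\<close>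

definition supp :: "('a \<Rightarrow> 'f::zero) \<Rightarrow> 'a set" where
  "supp w = {x. w x \<noteq> 0}"

definition moment :: "('f::{field,finite} \<Rightarrow> 'f) \<Rightarrow> nat \<Rightarrow> 'f" where
  "moment w k = (\<Sum>x\<in>UNIV. w x * x ^ k)"

definition sparse_weights :: "nat \<Rightarrow> ('f::{field,finite} \<Rightarrow> 'f) set" where
  "sparse_weights q = {w. w 0 = 0 \<and> card (supp w) \<le> q}"

definition attainable :: "nat \<Rightarrow> nat \<Rightarrow> (nat \<Rightarrow> 'f) \<Rightarrow> ('f::{field,finite}) set" where
  "attainable d q v = {moment w 0 | w. w \<in> sparse_weights q \<and> (\<forall>k\<in>{1..d}. moment w k = v k)}"

definition max_attainable :: "('f::{field,finite}) itself \<Rightarrow> nat \<Rightarrow> nat \<Rightarrow> nat" where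
  "max_attainable _ d q = Max (range (\<lambda>v :: nat \<Rightarrow> 'f. card (attainable d q v)))"

lemma moment_diff: "moment (\<lambda>x. w x - w' x) k = moment w k - moment w' k"
  by (simp add: moment_def left_diff_distrib sum_subtractf)

lemma sum_weight_poly:
  assumes "degree A \<le> d"
  shows "(\<Sum>x\<in>UNIV. w x * poly A x) = (\<Sum>k\<le>d. moment w k * coeff A k)"
proof -
  have "poly A x = (\<Sum>k\<le>d. coeff A k * x ^ k)" for x
    unfolding poly_altdef using assms
    by (intro sum.mono_neutral_left) (auto simp: coeff_eq_0)
  then have "(\<Sum>x\<in>UNIV. w x * poly A x) = (\<Sum>x\<in>UNIV. \<Sum>k\<le>d. w x * x ^ k * coeff A k)"
    by (simp add: sum_distrib_left mult_ac)
  also have "\<dots> = (\<Sum>k\<le>d. \<Sum>x\<in>UNIV. w x * x ^ k * coeff A k)"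
    by (rule sum.swap)
  finally show ?thesis
    by (simp add: moment_def sum_distrib_right)
qed

lemma vandermonde:
  fixes w :: "'f::{field,finite} \<Rightarrow> 'f"
  assumes card: "card (supp w) \<le> n" and zero: "\<And>k. k < n \<Longrightarrow> moment w k = 0"
  shows "w x = 0"
proof (rule ccontr)
  assume x: "w x \<noteq> 0"
  define p where "p = (\<Prod>z\<in>supp w - {x}. [:- z, 1:])"
  have deg: "degree p = card (supp w - {x})"
    unfolding p_def by (subst degree_prod_eq_sum_degree) auto
  have "x \<in> supp w" using x by (simp add: supp_def)
  then have lt: "degree p < n"
    using card deg card_Diff1_less[of "supp w" x] by (simp del: card_Diff_insert)
  have p0: "poly p z = 0 \<longleftrightarrow> z \<in> supp w - {x}" for z
    by (auto simp: p_def poly_prod prod_zero_iff)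
  have "0 = (\<Sum>k\<le>degree p. moment w k * coeff p k)"
    using lt zero by (intro sum.neutral[symmetric]) auto
  also have "\<dots> = (\<Sum>z\<in>UNIV. w z * poly p z)"
    by (rule sum_weight_poly[symmetric]) simp
  also have "\<dots> = (\<Sum>z\<in>{x}. w z * poly p z)"
    using p0 by (intro sum.mono_neutral_right) (auto simp: supp_def)
  finally show False using x p0[of x] by simp
qed

lemma vandermonde_shifted:
  fixes w :: "'f::{field,finite} \<Rightarrow> 'f"
  assumes w0: "w 0 = 0" and card: "card (supp w) \<le> n"
    and zero: "\<And>k. k \<in> {1..n} \<Longrightarrow> moment w k = 0"
  shows "w x = 0"
proof (cases "x = 0")
  case False
  have "supp (\<lambda>z. w z * z) = supp w"
    using w0 by (auto simp: supp_def)
  moreover have "moment (\<lambda>z. w z * z) k = moment w (Suc k)" for k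
    by (simp add: moment_def mult_ac)
  ultimately have "w x * x = 0"
    using card zero by (intro vandermonde[of "\<lambda>z. w z * z" n]) auto
  then show ?thesis using False by simp
qed (simp add: w0)

lemma card_attainable_le_max:
  fixes v :: "nat \<Rightarrow> 'f::{field,finite}"
  shows "card (attainable d q v) \<le> max_attainable TYPE('f) d q"
proof -
  have "range (\<lambda>v :: nat \<Rightarrow> 'f. card (attainable d q v)) \<subseteq> {..CARD('f)}"
    by (auto intro: card_mono)
  then have "finite (range (\<lambda>v :: nat \<Rightarrow> 'f. card (attainable d q v)))"
    using finite_subset by blast
  then show ?thesis unfolding max_attainable_def by (intro Max_ge) auto
qed

lemma max_attainable_witness:
  obtains v :: "nat \<Rightarrow> 'f::{field,finite}"
  where "card (attainable d q v) = max_attainable TYPE('f) d q"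
proof -
  have "range (\<lambda>v :: nat \<Rightarrow> 'f. card (attainable d q v)) \<subseteq> {..CARD('f)}"
    by (auto intro: card_mono)
  then have "finite (range (\<lambda>v :: nat \<Rightarrow> 'f. card (attainable d q v)))"
    using finite_subset by blast
  then have "max_attainable TYPE('f) d q \<in> range (\<lambda>v :: nat \<Rightarrow> 'f. card (attainable d q v))"
    unfolding max_attainable_def by (intro Max_in) auto
  then show ?thesis using that by auto
qed

lemma sparse_diff:
  assumes "w \<in> sparse_weights q" "w' \<in> sparse_weights q"
  shows "supp (\<lambda>x. w x - w' x) \<subseteq> supp w \<union> supp w'" "w 0 - w' 0 = 0"
    "card (supp w \<union> supp w') \<le> 2 * q"
  using assms card_Un_le[of "supp w" "supp w'"] by (auto simp: sparse_weights_def supp_def)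

lemma zero_sparse: "(\<lambda>_. 0) \<in> sparse_weights q"
  by (simp add: sparse_weights_def supp_def)

lemma max_attainable_pos: "max_attainable TYPE('f::{field,finite}) d q > 0"
proof -
  have "moment (\<lambda>_. 0 :: 'f) 0 \<in> attainable d q (\<lambda>_. 0)"
    unfolding attainable_def using zero_sparse by (force simp: moment_def)
  then have "card (attainable d q (\<lambda>_. 0 :: 'f)) > 0"
    by (auto simp: card_gt_0_iff)
  then show ?thesis using card_attainable_le_max[of d q "\<lambda>_. 0 :: 'f"] by linarith
qed

lemma max_attainable_few_queries:
  assumes "2 * q \<le> d"
  shows "max_attainable TYPE('f::{field,finite}) d q = 1"
proof -
  obtain v :: "nat \<Rightarrow> 'f" where v: "card (attainable d q v) = max_attainable TYPE('f) d q"
    by (rule max_attainable_witness)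
  have "\<gamma> = \<gamma>'" if mem: "\<gamma> \<in> attainable d q v" "\<gamma>' \<in> attainable d q v" for \<gamma> \<gamma>'
  proof -
    obtain w w' where w: "\<gamma> = moment w 0" "w \<in> sparse_weights q" "\<forall>k\<in>{1..d}. moment w k = v k"
      "\<gamma>' = moment w' 0" "w' \<in> sparse_weights q" "\<forall>k\<in>{1..d}. moment w' k = v k"
      using mem unfolding attainable_def by blast
    have "card (supp (\<lambda>x. w x - w' x)) \<le> d"
      using sparse_diff[OF w(2,5)] assms card_mono[of "supp w \<union> supp w'" "supp (\<lambda>x. w x - w' x)"]
      by simp
    then have "w x - w' x = 0" for x
      by (rule vandermonde_shifted[of "\<lambda>x. w x - w' x" d, rotated])
        (use w sparse_diff(2)[OF w(2,5)] in \<open>auto simp: moment_diff\<close>)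
    then have "w = w'" by (intro ext) simp
    then show ?thesis using w by simp
  qed
  then have "card (attainable d q v) \<le> 1"
    by (subst card_le_Suc0_iff_eq[unfolded One_nat_def[symmetric]]) auto
  with v max_attainable_pos[where 'f='f, of d q] show ?thesis by linarith
qed

text \<open>
  For \<open>d + 1 = 2 * q\<close> two distinct values for the same \<open>v\<close> come from weights with disjoint supports
  of full size \<open>q\<close>, since otherwise their difference would be annihilated by \<open>d\<close> moments.
\<close>

lemma max_attainable_critical_le:
  assumes d: "2 * q = d + 1" and q: "q \<le> CARD('f) - 1"
  shows "max_attainable TYPE('f::{field,finite}) d q * q \<le> CARD('f) - 1"
proof -
  obtain v :: "nat \<Rightarrow> 'f" where v: "card (attainable d q v) = max_attainable TYPE('f) d q"
    by (rule max_attainable_witness)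
  let ?M = "attainable d q v"
  show ?thesis
  proof (cases "card ?M \<le> 1")
    case True
    then have "max_attainable TYPE('f) d q * q \<le> 1 * q" unfolding v by (rule mult_right_mono) simp
    with q show ?thesis by linarith
  next
    case False
    have "\<forall>\<gamma>\<in>?M. \<exists>w. \<gamma> = moment w 0 \<and> w \<in> sparse_weights q \<and> (\<forall>k\<in>{1..d}. moment w k = v k)"
      by (auto simp: attainable_def)
    then obtain W where W: "\<And>\<gamma>. \<gamma> \<in> ?M \<Longrightarrow> \<gamma> = moment (W \<gamma>) 0"
      "\<And>\<gamma>. \<gamma> \<in> ?M \<Longrightarrow> W \<gamma> \<in> sparse_weights q"
      "\<And>\<gamma> k. \<gamma> \<in> ?M \<Longrightarrow> k \<in> {1..d} \<Longrightarrow> moment (W \<gamma>) k = v k"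
      by metis
    have big: "card (supp (W \<gamma>) \<union> supp (W \<gamma>')) \<ge> 2 * q"
      if ne: "\<gamma> \<in> ?M" "\<gamma>' \<in> ?M" "\<gamma> \<noteq> \<gamma>'" for \<gamma> \<gamma>'
    proof (rule ccontr)
      assume "\<not> ?thesis"
      then have "card (supp (\<lambda>x. W \<gamma> x - W \<gamma>' x)) \<le> d"
        using d sparse_diff(1)[OF W(2)[OF ne(1)] W(2)[OF ne(2)]]
          card_mono[of "supp (W \<gamma>) \<union> supp (W \<gamma>')" "supp (\<lambda>x. W \<gamma> x - W \<gamma>' x)"]
        by simp
      then have "W \<gamma> x - W \<gamma>' x = 0" for x
        by (rule vandermonde_shifted[of "\<lambda>x. W \<gamma> x - W \<gamma>' x" d, rotated])
          (use W(3) ne sparse_diff(2)[OF W(2)[OF ne(1)] W(2)[OF ne(2)]] in \<open>auto simp: moment_diff\<close>)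
      then have "W \<gamma> = W \<gamma>'" by (intro ext) simp
      with W(1) ne show False by metis
    qed
    have le: "card (supp (W \<gamma>)) \<le> q" if "\<gamma> \<in> ?M" for \<gamma>
      using W(2)[OF that] by (simp add: sparse_weights_def)
    have disj: "supp (W \<gamma>) \<inter> supp (W \<gamma>') = {}" if "\<gamma> \<in> ?M" "\<gamma>' \<in> ?M" "\<gamma> \<noteq> \<gamma>'" for \<gamma> \<gamma>'
      using big[OF that] le[OF that(1)] le[OF that(2)] card_Un_Int[of "supp (W \<gamma>)" "supp (W \<gamma>')"]
      by (simp flip: card_0_eq)
    have eq: "card (supp (W \<gamma>)) = q" if m: "\<gamma> \<in> ?M" for \<gamma>
    proof -
      obtain \<gamma>' where m': "\<gamma>' \<in> ?M" "\<gamma>' \<noteq> \<gamma>"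
        using False m by (auto simp: card_le_Suc0_iff_eq)
      show ?thesis
        using big[OF m m'(1)] le[OF m] le[OF m'(1)] m'(2)
          card_Un_le[of "supp (W \<gamma>)" "supp (W \<gamma>')"] by auto
    qed
    have "card ?M * q = (\<Sum>\<gamma>\<in>?M. card (supp (W \<gamma>)))"
      using eq by simp
    also have "\<dots> = card (\<Union>\<gamma>\<in>?M. supp (W \<gamma>))"
      using disj by (intro card_UN_disjoint[symmetric]) auto
    also have "\<dots> \<le> card (UNIV - {0 :: 'f})"
      using W(2) by (intro card_mono) (auto simp: sparse_weights_def supp_def)
    also have "\<dots> = CARD('f) - 1" by (simp add: card_Diff_subset)
    finally show ?thesis using v by simp
  qed
qed

lemma finite_field_power_card_minus_1:
  fixes a :: "'f::{field,finite}"
  assumes "a \<noteq> 0"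
  shows "a ^ (CARD('f) - 1) = 1"
proof -
  let ?U = "UNIV - {0 :: 'f}"
  have "(\<Prod>x\<in>?U. x) = (\<Prod>x\<in>?U. a * x)"
    using assms by (intro prod.reindex_bij_witness[of _ "\<lambda>x. a * x" "\<lambda>x. x / a"]) auto
  also have "\<dots> = a ^ card ?U * (\<Prod>x\<in>?U. x)"
    by (simp add: prod.distrib)
  finally have "a ^ card ?U = 1"
    by simp
  then show ?thesis by (simp add: card_Diff_subset)
qed

lemma card_roots_of_unity_le:
  assumes "n > 0"
  shows "card {x :: 'a::field. x ^ n = 1} \<le> n"
proof -
  have deg: "degree (monom (1 :: 'a) n + - 1) = n"
    using assms by (subst degree_add_eq_left) (auto simp: degree_monom_eq)
  then have "monom (1 :: 'a) n + - 1 \<noteq> 0"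
    using assms by (metis degree_0 less_irrefl)
  from card_poly_roots_bound[OF this] show ?thesis
    unfolding deg by (simp add: poly_monom)
qed

lemma card_roots_of_unity:
  assumes "q dvd CARD('f) - 1" "q > 0"
  shows "card {x :: 'f::{field,finite}. x ^ q = 1} = q"
proof -
  let ?n = "CARD('f) - 1"
  obtain r where r: "?n = q * r" using assms(1) by blast
  have "card {0 :: 'f, 1} \<le> CARD('f)" by (intro card_mono) auto
  then have n: "?n > 0" by simp
  then have r0: "r > 0" using r by (cases r) auto
  let ?g = "\<Sum>i<r. monom (1 :: 'f) (q * i)"
  have g: "(x ^ q - 1) * poly ?g x = x ^ ?n - 1" for x
    using power_diff_1_eq[of "x ^ q" r]
    by (simp add: r[simplified] poly_sum poly_monom power_mult[symmetric])
  have "poly ?g 0 = (\<Sum>i<r. if i = 0 then 1 else 0)"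
    using assms(2) by (auto simp: poly_sum poly_monom power_0_left intro!: sum.cong)
  then have "poly ?g 0 = 1" using r0 by simp
  then have g0: "?g \<noteq> 0" by (metis poly_0 zero_neq_one)
  have "degree ?g \<le> q * (r - 1)"
    by (intro degree_sum_le) (auto intro!: order_trans[OF degree_monom_le])
  then have cg: "card {x. poly ?g x = 0} \<le> q * (r - 1)"
    using card_poly_roots_bound[OF g0] by linarith
  have "UNIV - {0} \<subseteq> {x :: 'f. x ^ q = 1} \<union> {x. poly ?g x = 0}"
  proof
    fix x :: 'f assume "x \<in> UNIV - {0}"
    then have "(x ^ q - 1) * poly ?g x = 0"
      unfolding g by (simp add: finite_field_power_card_minus_1[simplified])
    then show "x \<in> {x. x ^ q = 1} \<union> {x. poly ?g x = 0}" by simp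
  qed
  from card_mono[OF _ this]
  have "?n \<le> card ({x :: 'f. x ^ q = 1} \<union> {x. poly ?g x = 0})"
    by (simp add: card_Diff_subset)
  also have "\<dots> \<le> card {x :: 'f. x ^ q = 1} + q * (r - 1)"
    using card_Un_le[of "{x :: 'f. x ^ q = 1}" "{x. poly ?g x = 0}"] cg by linarith
  finally have "q \<le> card {x :: 'f. x ^ q = 1}"
    using r r0 by (cases r) simp_all
  moreover have "card {x :: 'f. x ^ q = 1} \<le> q"
    using assms(2) by (rule card_roots_of_unity_le)
  ultimately show ?thesis by simp
qed

lemma max_attainable_critical_eq:
  assumes d: "2 * q = d + 1" and q: "q dvd CARD('f) - 1"
  shows "max_attainable TYPE('f::{field,finite}) d q * q = CARD('f) - 1"
proof (rule antisym)
  have "card {0 :: 'f, 1} \<le> CARD('f)" by (intro card_mono) auto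
  then have n: "CARD('f) - 1 > 0" by simp
  have "q > 0" using d by simp
  note card_mu = card_roots_of_unity[where 'f = 'f, OF q \<open>q > 0\<close>]
  show "max_attainable TYPE('f) d q * q \<le> CARD('f) - 1"
    using d dvd_imp_le[OF q n] by (rule max_attainable_critical_le)
  let ?B = "(\<lambda>x :: 'f. x ^ q) ` (UNIV - {0})"
  let ?F = "\<lambda>\<beta> :: 'f. {x. x ^ q = \<beta>}"
  have fibre: "?F (b ^ q) = (\<lambda>x. b * x) ` {x. x ^ q = 1}" if "b \<noteq> 0" for b :: 'f
  proof -
    have "x \<in> (\<lambda>x. b * x) ` {x. x ^ q = 1}" if "x ^ q = b ^ q" for x
      using that \<open>b \<noteq> 0\<close> by (intro image_eqI[of _ _ "x / b"]) (auto simp: power_divide)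
    then show ?thesis by (auto simp: power_mult_distrib)
  qed
  have card_fibre: "card (?F \<beta>) = q" if "\<beta> \<in> ?B" for \<beta>
  proof -
    obtain b where b: "b \<noteq> 0" "\<beta> = b ^ q" using \<open>\<beta> \<in> ?B\<close> by auto
    have "inj_on (\<lambda>x. b * x) {x. x ^ q = 1}" using b by (auto simp: inj_on_def)
    then show ?thesis using fibre[OF b(1)] b card_mu by (simp add: card_image)
  qed
  define w where "w = (\<lambda>\<beta> x :: 'f. if x ^ q = \<beta> then inverse \<beta> else 0)"
  have supp_w: "supp (w \<beta>) = ?F \<beta>" if "\<beta> \<in> ?B" for \<beta>
    using that \<open>q > 0\<close> by (auto simp: supp_def w_def)
  have w_sparse: "w \<beta> \<in> sparse_weights q" if "\<beta> \<in> ?B" for \<beta>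
    using supp_w[OF that] card_fibre[OF that] that \<open>q > 0\<close>
    by (auto simp: sparse_weights_def w_def power_0_left)
  have moment_w: "moment (w \<beta>) k = inverse \<beta> * (\<Sum>x\<in>?F \<beta>. x ^ k)" for \<beta> k
  proof -
    have "moment (w \<beta>) k = (\<Sum>x\<in>UNIV. if x \<in> ?F \<beta> then inverse \<beta> * x ^ k else 0)"
      unfolding moment_def w_def by (intro sum.cong) auto
    also have "\<dots> = (\<Sum>x\<in>?F \<beta>. inverse \<beta> * x ^ k)"
      by (subst sum.inter_filter[symmetric]) auto
    finally show ?thesis by (simp add: sum_distrib_left)
  qed
  have power_sum_0: "(\<Sum>x\<in>?F \<beta>. x ^ k) = 0" if \<beta>: "\<beta> \<in> ?B" and k: "k \<in> {1..d}" "k \<noteq> q" for \<beta> k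
  proof -
    obtain \<zeta> :: 'f where \<zeta>: "\<zeta> ^ q = 1" "\<zeta> ^ k \<noteq> 1"
    proof -
      define j where "j = (if k < q then k else k - q)"
      have j: "0 < j" "j < q" using k d by (auto simp: j_def)
      have "card {x :: 'f. x ^ j = 1} < card {x :: 'f. x ^ q = 1}"
        using card_roots_of_unity_le[OF j(1), where 'a = 'f] j(2) card_mu by linarith
      then obtain \<zeta> :: 'f where "\<zeta> ^ q = 1" "\<zeta> ^ j \<noteq> 1"
        by (metis (mono_tags, lifting) card_mono finite leD mem_Collect_eq subsetI)
      moreover from this have "\<zeta> ^ k = \<zeta> ^ j"
        using power_add[of \<zeta> q "k - q"] by (auto simp: j_def)
      ultimately show ?thesis using that by simp
    qed
    have "\<zeta> \<noteq> 0" using \<zeta>(1) \<open>q > 0\<close> by (auto simp: power_0_left)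
    have "(\<Sum>x\<in>?F \<beta>. x ^ k) = (\<Sum>x\<in>?F \<beta>. (\<zeta> * x) ^ k)"
      using \<zeta> \<open>\<zeta> \<noteq> 0\<close>
      by (intro sum.reindex_bij_witness[of _ "\<lambda>x. \<zeta> * x" "\<lambda>x. x / \<zeta>"])
        (auto simp: power_mult_distrib power_divide)
    also have "\<dots> = \<zeta> ^ k * (\<Sum>x\<in>?F \<beta>. x ^ k)"
      by (simp add: power_mult_distrib sum_distrib_left)
    finally have "(1 - \<zeta> ^ k) * (\<Sum>x\<in>?F \<beta>. x ^ k) = 0"
      by (simp add: left_diff_distrib)
    then show ?thesis using \<zeta>(2) by simp
  qed
  define v :: "nat \<Rightarrow> 'f" where "v = (\<lambda>k. if k = q then of_nat q else 0)"
  have mk: "\<forall>k\<in>{1..d}. moment (w \<beta>) k = v k" if \<beta>: "\<beta> \<in> ?B" for \<beta>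
  proof
    fix k assume "k \<in> {1..d}"
    then show "moment (w \<beta>) k = v k"
      using power_sum_0[OF \<beta>] card_fibre[OF \<beta>] \<beta> by (cases "k = q") (auto simp: moment_w v_def)
  qed
  have m0: "moment (w \<beta>) 0 = of_nat q * inverse \<beta>" if "\<beta> \<in> ?B" for \<beta>
    using card_fibre[OF that] by (simp add: moment_w)
  have sub: "(\<lambda>\<beta>. of_nat q * inverse \<beta>) ` ?B \<subseteq> attainable d q v"
  proof (rule image_subsetI)
    fix \<beta> assume "\<beta> \<in> ?B"
    then show "of_nat q * inverse \<beta> \<in> attainable d q v"
      unfolding attainable_def mem_Collect_eq
      by (intro exI[of _ "w \<beta>"] conjI m0[symmetric] w_sparse mk)
  qed
  have "of_nat q \<noteq> (0 :: 'f)"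
  proof
    assume "of_nat q = (0 :: 'f)"
    moreover obtain r where r: "CARD('f) - 1 = q * r" using q by blast
    ultimately have "of_nat (CARD('f) - 1) = (0 :: 'f)" by (simp only: r of_nat_mult) simp
    moreover have "of_nat CARD('f) = (0 :: 'f)"
    proof -
      have "(\<Sum>x :: 'f\<in>UNIV. x) = (\<Sum>x\<in>UNIV. x + 1)"
        by (intro sum.reindex_bij_witness[of _ "\<lambda>x. x + 1" "\<lambda>x. x - 1"]) auto
      then show ?thesis by (simp add: sum.distrib)
    qed
    ultimately have "(1 :: 'f) = 0" using n by (metis One_nat_def Suc_pred add.right_neutral of_nat_Suc zero_less_card_finite)
    then show False by simp
  qed
  then have "inj_on (\<lambda>\<beta>. of_nat q * inverse \<beta>) ?B" by (auto simp: inj_on_def)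
  then have "card ?B \<le> max_attainable TYPE('f) d q"
    using card_mono[OF _ sub] card_attainable_le_max[of d q v] by (simp add: card_image)
  moreover have "CARD('f) - 1 \<le> card ?B * q"
  proof -
    have "CARD('f) - 1 = card (UNIV - {0 :: 'f})" by (simp add: card_Diff_subset)
    also have "\<dots> \<le> card (\<Union>\<beta>\<in>?B. ?F \<beta>)" by (intro card_mono) auto
    also have "\<dots> \<le> (\<Sum>\<beta>\<in>?B. card (?F \<beta>))" by (intro card_UN_le) auto
    also have "\<dots> = card ?B * q" using card_fibre by simp
    finally show ?thesis .
  qed
  ultimately show "CARD('f) - 1 \<le> max_attainable TYPE('f) d q * q"
    using mult_le_mono1 order_trans by blast
qed

section \<open>A second moment bound\<close>

lemma card_squared_le_card_image_times_collisions:
  assumes "finite A"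
  shows "(card A)\<^sup>2 \<le> card (f ` A) * card {(x, y) \<in> A \<times> A. f x = f y}"
proof -
  let ?F = "\<lambda>c. {x \<in> A. f x = c}"
  have "card A = (\<Sum>c\<in>f ` A. card (?F c))"
    using assms by (simp add: sum_fun_comp[of A "f ` A" f "\<lambda>_. 1 :: nat", simplified])
  moreover have "{(x, y) \<in> A \<times> A. f x = f y} = (\<Union>c\<in>f ` A. ?F c \<times> ?F c)"
    by auto
  then have "card {(x, y) \<in> A \<times> A. f x = f y} = (\<Sum>c\<in>f ` A. card (?F c \<times> ?F c))"
    using assms by (simp only:) (intro card_UN_disjoint; auto)
  ultimately have "real ((card A)\<^sup>2) = (\<Sum>c\<in>f ` A. real (card (?F c)))\<^sup>2"
    "real (card {(x, y) \<in> A \<times> A. f x = f y}) = (\<Sum>c\<in>f ` A. (real (card (?F c)))\<^sup>2)"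
    by (simp_all add: power2_eq_square card_cartesian_product)
  with sum_squared_le_sum_of_squares[of "\<lambda>c. real (card (?F c))" "f ` A"]
  have "real ((card A)\<^sup>2) \<le> real (card (f ` A) * card {(x, y) \<in> A \<times> A. f x = f y})"
    by (simp add: mult.commute)
  then show ?thesis by (simp only: of_nat_le_iff)
qed

definition weights_on :: "'f set \<Rightarrow> nat \<Rightarrow> ('f \<Rightarrow> 'f::{field,finite}) set" where
  "weights_on X q = {w. supp w \<subseteq> X \<and> card (supp w) = q}"

definition attainable_on :: "'f set \<Rightarrow> nat \<Rightarrow> nat \<Rightarrow> (nat \<Rightarrow> 'f) \<Rightarrow> ('f::{field,finite}) set" where
  "attainable_on X d q v =
    {moment w 0 | w. w \<in> weights_on X q \<and> (\<forall>k\<in>{1..d}. moment w k = v k)}"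

lemma card_weights_on:
  fixes X :: "'f::{field,finite} set"
  shows "card (weights_on X q) = (card X choose q) * (CARD('f) - 1) ^ q"
proof -
  let ?S = "{S. S \<subseteq> X \<and> card S = q}"
  let ?T = "SIGMA S:?S. PiE S (\<lambda>_. UNIV - {0 :: 'f})"
  have "bij_betw (\<lambda>w. (supp w, restrict w (supp w))) (weights_on X q) ?T"
  proof (rule bij_betw_byWitness[where f' = "\<lambda>(S, f) x. if x \<in> S then f x else 0"])
    show "(\<lambda>w. (supp w, restrict w (supp w))) ` weights_on X q \<subseteq> ?T"
      by (auto simp: weights_on_def supp_def)
    have supp: "supp (\<lambda>x. if x \<in> S then f x else 0) = S" if "f \<in> PiE S (\<lambda>_. UNIV - {0 :: 'f})" for S :: "'f set" and f
      using that by (auto simp: supp_def PiE_def Pi_def)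
    show "(\<lambda>(S, f) x. if x \<in> S then f x else 0) ` ?T \<subseteq> weights_on X q"
      by (auto simp: weights_on_def supp)
    show "\<forall>p\<in>?T. (\<lambda>w. (supp w, restrict w (supp w))) ((\<lambda>(S, f) x. if x \<in> S then f x else 0) p) = p"
      by (auto simp: supp restrict_def PiE_def extensional_def fun_eq_iff)
  qed (auto simp: supp_def fun_eq_iff)
  then have "card (weights_on X q) = card ?T" by (rule bij_betw_same_card)
  also have "\<dots> = (\<Sum>S\<in>?S. card (PiE S (\<lambda>_. UNIV - {0 :: 'f})))"
    by (intro card_SigmaI) auto
  also have "\<dots> = (\<Sum>S\<in>?S. (CARD('f) - 1) ^ q)"
    by (intro sum.cong) (auto simp: card_PiE card_Diff_subset)
  also have "\<dots> = (card X choose q) * (CARD('f) - 1) ^ q"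
    by (simp add: n_subsets)
  finally show ?thesis .
qed

text \<open>
  A nontrivial relation between \<open>d + 1\<close> moments needs at least \<open>d + 2 = 2 * q\<close> points. So colliding
  weights have disjoint supports, and given the supports they are determined up to a scalar.
\<close>

lemma card_collisions_le:
  fixes X :: "'f::{field,finite} set"
  assumes d: "2 * q = d + 2"
  shows "card {(w, w') \<in> weights_on X q \<times> weights_on X q. \<forall>k\<le>d. moment w k = moment w' k}
    \<le> card (weights_on X q) + (card X choose q) * (card X - q choose q) * (CARD('f) - 1)"
proof -
  let ?K = "{(w, w') \<in> weights_on X q \<times> weights_on X q. \<forall>k\<le>d. moment w k = moment w' k}"
  let ?K' = "{(w, w') \<in> ?K. w \<noteq> w'}"
  let ?S = "\<lambda>Y. {S. S \<subseteq> Y \<and> card S = q}"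
  let ?T = "(SIGMA S:?S X. ?S (X - S)) \<times> (UNIV - {0 :: 'f})"
  define pick where "pick S = (SOME x. x \<in> S)" for S :: "'f set"
  define g where "g = (\<lambda>(w :: 'f \<Rightarrow> 'f, w' :: 'f \<Rightarrow> 'f). ((supp w, supp w'), w (pick (supp w))))"
  have pick: "pick (supp w) \<in> supp w" if "w \<in> weights_on X q" for w
  proof -
    have "supp w \<noteq> {}" using that d by (auto simp: weights_on_def)
    then show ?thesis unfolding pick_def by (rule some_in_eq[THEN iffD2])
  qed
  have disj: "supp w \<inter> supp w' = {}" if "(w, w') \<in> ?K'" for w w'
  proof (rule ccontr)
    assume "supp w \<inter> supp w' \<noteq> {}"
    then have "card (supp w \<inter> supp w') > 0" by (simp add: card_gt_0_iff)
    moreover have "card (supp w) = q" "card (supp w') = q" using that by (auto simp: weights_on_def)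
    ultimately have "card (supp w \<union> supp w') \<le> d + 1"
      using card_Un_Int[of "supp w" "supp w'"] d by simp
    moreover have "card (supp (\<lambda>x. w x - w' x)) \<le> card (supp w \<union> supp w')"
      by (intro card_mono) (auto simp: supp_def)
    ultimately have "card (supp (\<lambda>x. w x - w' x)) \<le> d + 1" by simp
    then have "w x - w' x = 0" for x
      by (rule vandermonde[of "\<lambda>x. w x - w' x" "d + 1"]) (use that in \<open>auto simp: moment_diff\<close>)
    then have "w = w'" by (intro ext) simp
    with that show False by simp
  qed
  have "w1 = w2 \<and> w1' = w2'"
    if K1: "w1 \<in> weights_on X q" "w1' \<in> weights_on X q" "\<forall>k\<le>d. moment w1 k = moment w1' k" "w1 \<noteq> w1'"
      and K2: "w2 \<in> weights_on X q" "w2' \<in> weights_on X q" "\<forall>k\<le>d. moment w2 k = moment w2' k" "w2 \<noteq> w2'"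
      and eq: "g (w1, w1') = g (w2, w2')" for w1 w1' w2 w2'
  proof -
    let ?x = "pick (supp w1)"
    let ?u = "\<lambda>x. (w1 x - w1' x) - (w2 x - w2' x)"
    have s: "supp w2 = supp w1" "supp w2' = supp w1'" "w1 ?x = w2 ?x"
      using eq by (auto simp: g_def)
    have d1: "supp w1 \<inter> supp w1' = {}" using disj[of w1 w1'] K1 by blast
    have x: "?x \<in> supp w1" using pick K1 by blast
    then have x': "?x \<notin> supp w1'" using d1 by blast
    have zero: "w1 x = 0 \<longleftrightarrow> w2 x = 0" "w1' x = 0 \<longleftrightarrow> w2' x = 0" for x
      using s(1,2) by (auto simp: supp_def set_eq_iff)
    have "?u ?x = 0" using x' s(3) zero(2)[of ?x] by (auto simp: supp_def)
    moreover have "?u x = 0" if "x \<notin> supp w1" "x \<notin> supp w1'" for x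
      using that zero[of x] by (auto simp: supp_def)
    ultimately have "supp ?u \<subseteq> (supp w1 \<union> supp w1') - {?x}"
      unfolding supp_def[of ?u] by blast
    then have "card (supp ?u) \<le> card ((supp w1 \<union> supp w1') - {?x})"
      by (intro card_mono) auto
    also have "\<dots> < card (supp w1 \<union> supp w1')"
      using x by (intro psubset_card_mono) auto
    also have "\<dots> \<le> d + 2"
      using K1 d card_Un_le[of "supp w1" "supp w1'"] by (auto simp: weights_on_def)
    finally have "card (supp ?u) \<le> d + 1" by simp
    then have u: "?u x = 0" for x
      by (rule vandermonde[of ?u "d + 1"])
        (use K1 K2 in \<open>auto simp: moment_diff\<close>)
    have "w1 x = w2 x \<and> w1' x = w2' x" for x
    proof (cases "x \<in> supp w1")
      case True
      then have "x \<notin> supp w1'" using d1 by blast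
      then have "w1' x = 0" "w2' x = 0" using zero[of x] by (auto simp: supp_def)
      then show ?thesis using u[of x] by simp
    next
      case False
      then have "w1 x = 0" "w2 x = 0" using zero[of x] by (auto simp: supp_def)
      then show ?thesis using u[of x] by simp
    qed
    then show ?thesis by auto
  qed
  then have "inj_on g ?K'" unfolding inj_on_def by blast
  moreover have "g (w, w') \<in> ?T"
    if K: "w \<in> weights_on X q" "w' \<in> weights_on X q" "\<forall>k\<le>d. moment w k = moment w' k" "w \<noteq> w'" for w w'
  proof -
    have "supp w \<inter> supp w' = {}" using disj[of w w'] K by blast
    moreover have "w (pick (supp w)) \<noteq> 0" using pick[of w] K by (auto simp: supp_def)
    ultimately show ?thesis using K by (auto simp: g_def weights_on_def)
  qed
  then have "g ` ?K' \<subseteq> ?T" by blast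
  ultimately have "card ?K' \<le> card ?T"
    by (intro card_inj_on_le[of g]) auto
  also have "card ?T = (\<Sum>S\<in>?S X. card (?S (X - S))) * (CARD('f) - 1)"
    by (subst card_cartesian_product, subst card_SigmaI) (auto simp: card_Diff_subset)
  also have "(\<Sum>S\<in>?S X. card (?S (X - S))) = (\<Sum>S\<in>?S X. (card X - q choose q))"
    by (intro sum.cong) (auto simp: n_subsets card_Diff_subset)
  also have "\<dots> = (card X choose q) * (card X - q choose q)"
    by (simp add: n_subsets)
  finally have K': "card ?K' \<le> (card X choose q) * (card X - q choose q) * (CARD('f) - 1)" .
  have "?K \<subseteq> (\<lambda>w. (w, w)) ` weights_on X q \<union> ?K'" by auto
  then have "card ?K \<le> card ((\<lambda>w. (w, w)) ` weights_on X q \<union> ?K')"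
    by (intro card_mono) auto
  also have "\<dots> \<le> card ((\<lambda>w. (w, w)) ` weights_on X q) + card ?K'" by (rule card_Un_le)
  also have "\<dots> \<le> card (weights_on X q) + card ?K'"
    by (intro add_right_mono card_image_le) auto
  finally show ?thesis using K' by linarith
qed

lemma card_moment_image_le:
  fixes X :: "'f::{field,finite} set"
  obtains v where "card ((\<lambda>w. restrict (moment w) {..d}) ` weights_on X q)
    \<le> CARD('f) ^ d * card (attainable_on X d q v)"
proof -
  let ?V = "PiE {1..d} (\<lambda>_. UNIV :: 'f set)"
  let ?I = "(\<lambda>w. restrict (moment w) {..d}) ` weights_on X q"
  let ?c = "\<lambda>v. card (attainable_on X d q v)"
  have finV: "finite ?V" by (intro finite_PiE) auto
  moreover have "?V \<noteq> {}" by (simp add: PiE_eq_empty_iff)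
  ultimately have "Max (?c ` ?V) \<in> ?c ` ?V" by (intro Max_in) auto
  then obtain v where v: "Max (?c ` ?V) = ?c v" by auto
  have max: "?c v' \<le> ?c v" if "v' \<in> ?V" for v'
    unfolding v[symmetric] using finV that by (intro Max_ge) auto
  let ?h = "\<lambda>m. (restrict m {1..d}, m 0)"
  have "inj_on ?h ?I"
  proof (rule inj_onI, clarify)
    fix w w' :: "'f \<Rightarrow> 'f"
    assume eq: "restrict (restrict (moment w) {..d}) {1..d} = restrict (restrict (moment w') {..d}) {1..d}"
      "restrict (moment w) {..d} 0 = restrict (moment w') {..d} 0"
    have "moment w k = moment w' k" if "k \<le> d" for k
    proof (cases k)
      case 0 then show ?thesis using eq(2) by simp
    next
      case (Suc l)
      then show ?thesis using fun_cong[OF eq(1), of k] that by simp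
    qed
    then show "restrict (moment w) {..d} = restrict (moment w') {..d}" by (auto simp: restrict_def)
  qed
  moreover have "?h ` ?I \<subseteq> (SIGMA v':?V. attainable_on X d q v')"
    by (auto simp: attainable_on_def)
  ultimately have "card ?I \<le> card (SIGMA v':?V. attainable_on X d q v')"
    using finV by (intro card_inj_on_le[of ?h] finite_SigmaI) auto
  also have "\<dots> = (\<Sum>v'\<in>?V. ?c v')" using finV by (intro card_SigmaI) auto
  also have "\<dots> \<le> of_nat (card ?V) * ?c v" using max by (rule sum_bounded_above)
  also have "\<dots> = CARD('f) ^ d * ?c v" by (simp add: card_PiE)
  finally show ?thesis by (rule that)
qed

lemma prod_diff_ge:
  fixes N :: real
  assumes "N \<ge> 0" "\<And>i. i < q \<Longrightarrow> 0 \<le> x i \<and> x i \<le> N"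
  shows "N ^ q * (N - (\<Sum>i<q. x i)) \<le> N * (\<Prod>i<q. N - x i)"
  using assms(2)
proof (induction q)
  case (Suc q)
  have IH: "N ^ q * (N - (\<Sum>i<q. x i)) \<le> N * (\<Prod>i<q. N - x i)" using Suc by simp
  have "0 \<le> N ^ q * ((\<Sum>i<q. x i) * x q)"
    using Suc.prems \<open>N \<ge> 0\<close> by (intro mult_nonneg_nonneg sum_nonneg) auto
  then have "N ^ Suc q * (N - (\<Sum>i<Suc q. x i)) \<le> N ^ q * (N - (\<Sum>i<q. x i)) * (N - x q)"
    by (simp add: algebra_simps)
  also have "\<dots> \<le> N * (\<Prod>i<q. N - x i) * (N - x q)"
    using IH Suc.prems by (intro mult_right_mono) auto
  finally show ?case by (simp add: mult_ac)
qed simp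

lemma binomial_times_fact_ge:
  assumes "q + s \<le> N" "q > 0"
  shows "real N ^ q - (real q * real s + real q * (real q - 1) / 2) * real N ^ (q - 1)
    \<le> real (N - s choose q) * fact q"
proof -
  have "real N ^ q * (real N - (\<Sum>i<q. real (s + i))) \<le> real N * (\<Prod>i<q. real N - real (s + i))"
    using assms by (intro prod_diff_ge) auto
  moreover have "(\<Sum>i<q. real (s + i)) = real q * real s + real q * (real q - 1) / 2"
    by (induction q) (simp_all add: field_simps)
  moreover have "(\<Prod>i<q. real N - real (s + i)) = real (N - s choose q) * fact q"
    using assms by (simp add: binomial_gbinomial gbinomial_prod_rev of_nat_diff algebra_simps atLeast0LessThan)
  moreover have "real N ^ q = real N * real N ^ (q - 1)" using assms by (cases q) auto
  moreover have "real N > 0" using assms by simp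
  ultimately have "real N ^ (q - 1) * (real N - (real q * real s + real q * (real q - 1) / 2))
      \<le> real (N - s choose q) * fact q"
    by (simp only: mult.assoc mult_le_cancel_left_pos)
  then show ?thesis
    using \<open>real N ^ q = real N * real N ^ (q - 1)\<close> by (simp add: algebra_simps)
qed

lemma many_attainable_on:
  fixes X :: "'f::{field,finite} set" and q d :: nat and \<kappa> :: real
  defines "Q \<equiv> real CARD('f)"
  defines "e \<equiv> (Q - 1) ^ (q - 1)" and "b \<equiv> real (card X - q choose q)"
  assumes d: "2 * q = d + 2" and \<kappa>: "\<kappa> \<ge> 0" "\<kappa> < Q"
    and num: "(e + b) * (Q - \<kappa>) \<le> real (card X choose q) * Q"
  obtains v where "Q - (\<kappa> + real d + 1) \<le> real (card (attainable_on X d q v))"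
proof -
  define a where "a = real (card X choose q)"
  have "card {0 :: 'f, 1} \<le> CARD('f)" by (intro card_mono) auto
  then have Q: "Q \<ge> 2" by (simp add: Q_def)
  then have e: "e > 0" and b: "b \<ge> 0" by (auto simp: e_def b_def)
  let ?m = "\<lambda>w :: 'f \<Rightarrow> 'f. restrict (moment w) {..d}"
  obtain v where v: "card (?m ` weights_on X q) \<le> CARD('f) ^ d * card (attainable_on X d q v)"
    by (rule card_moment_image_le)
  define N where "N = real (card (attainable_on X d q v))"
  have "{(w, w') \<in> weights_on X q \<times> weights_on X q. ?m w = ?m w'} =
      {(w, w') \<in> weights_on X q \<times> weights_on X q. \<forall>k\<le>d. moment w k = moment w' k}"
    by (auto simp: restrict_def fun_eq_iff split: if_splits)
  then have "(card (weights_on X q))\<^sup>2 \<le> card (?m ` weights_on X q) *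
      card {(w, w') \<in> weights_on X q \<times> weights_on X q. \<forall>k\<le>d. moment w k = moment w' k}"
    using card_squared_le_card_image_times_collisions[of "weights_on X q" ?m] by simp
  also have "\<dots> \<le> (CARD('f) ^ d * card (attainable_on X d q v)) *
      (card (weights_on X q) + (card X choose q) * (card X - q choose q) * (CARD('f) - 1))"
    by (intro mult_le_mono v card_collisions_le d)
  finally have "real ((card (weights_on X q))\<^sup>2) \<le> real ((CARD('f) ^ d * card (attainable_on X d q v)) *
      (card (weights_on X q) + (card X choose q) * (card X - q choose q) * (CARD('f) - 1)))"
    by (simp only: of_nat_le_iff)
  moreover have Q1: "real (CARD('f) - 1) = Q - 1" using Q by (simp add: Q_def of_nat_diff)
  ultimately have le: "(a * (Q - 1) ^ q)\<^sup>2 \<le> Q ^ d * N * (a * (Q - 1) ^ q + a * b * (Q - 1))"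
    unfolding card_weights_on by (simp add: a_def b_def N_def Q_def del: of_nat_diff)
  have "a > 0"
  proof (rule ccontr)
    assume "\<not> a > 0"
    then have "(e + b) * (Q - \<kappa>) \<le> 0" using num unfolding a_def by (simp only: of_nat_0_less_iff not_less le_zero_eq of_nat_0 mult_zero_left)
    moreover have "(e + b) * (Q - \<kappa>) > 0" using e b \<kappa> by (intro mult_pos_pos) auto
    ultimately show False by simp
  qed
  have q: "q \<ge> 1" using d by simp
  then have pow: "(Q - 1) ^ q = (Q - 1) * e" by (cases q) (auto simp: e_def)
  have pow2: "(Q - 1) ^ (d + 1) = (Q - 1) * e * e"
  proof -
    have "d + 1 = q + (q - 1)" using d q by simp
    then show ?thesis by (simp only: power_add pow) (simp add: e_def)
  qed
  have "(a * (Q - 1)) * (a * ((Q - 1) * e * e)) \<le> (a * (Q - 1)) * (Q ^ d * N * (e + b))"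
    using le unfolding pow by (simp add: power2_eq_square algebra_simps)
  moreover have "a * (Q - 1) > 0" using \<open>a > 0\<close> Q by simp
  ultimately have main: "a * (Q - 1) ^ (d + 1) \<le> Q ^ d * N * (e + b)"
    unfolding pow2 by (simp only: mult_le_cancel_left_pos)
  define P where "P = (1 - 1 / Q) ^ (d + 1)"
  have P: "(Q - 1) ^ (d + 1) = Q * Q ^ d * P"
  proof -
    have "Q - 1 = Q * (1 - 1 / Q)" using Q by (simp add: field_simps)
    then have "(Q - 1) ^ (d + 1) = (Q * (1 - 1 / Q)) ^ (d + 1)" by simp
    then show ?thesis by (simp add: P_def power_mult_distrib mult_ac)
  qed
  have P01: "0 \<le> P" "P \<le> 1" unfolding P_def using Q by (intro zero_le_power power_le_one; simp)+
  have "1 + real (d + 1) * (- (1 / Q)) \<le> (1 + (- (1 / Q))) ^ (d + 1)"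
    using Q by (intro Bernoulli_inequality) auto
  then have P1: "1 - (real d + 1) / Q \<le> P" by (simp add: P_def add.commute)
  have "Q ^ d * ((Q - \<kappa>) * P * (e + b)) = Q ^ d * P * ((e + b) * (Q - \<kappa>))" by simp
  also have "\<dots> \<le> Q ^ d * P * (a * Q)"
    using num P01 Q by (intro mult_left_mono) (auto simp: a_def)
  also have "\<dots> = a * (Q - 1) ^ (d + 1)" unfolding P by simp
  also have "\<dots> \<le> Q ^ d * (N * (e + b))" using main by (simp add: mult_ac)
  finally have "(Q - \<kappa>) * P * (e + b) \<le> N * (e + b)"
    using Q by (simp add: mult_le_cancel_left_pos)
  then have "(Q - \<kappa>) * P \<le> N" using e b by (simp add: mult_le_cancel_right_pos)
  moreover have "Q * P \<ge> Q - (real d + 1)" using mult_left_mono[OF P1, of Q] Q by (simp add: right_diff_distrib)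
  moreover have "\<kappa> * P \<le> \<kappa>" using P01 \<kappa> by (simp add: mult_left_le)
  ultimately have "Q - (\<kappa> + real d + 1) \<le> N" by (simp add: left_diff_distrib)
  then show ?thesis using that unfolding N_def by blast
qed

lemma fact_ge_triangular: "q * (q + 1) div 2 \<le> fact q" if "q \<noteq> 2" for q :: nat
proof -
  have "q \<ge> 3 \<Longrightarrow> q * (q + 1) div 2 \<le> fact q"
  proof (induction q rule: dec_induct)
    case (step n)
    have "Suc n * (Suc n + 1) div 2 = n * (n + 1) div 2 + Suc n" by (simp add: algebra_simps)
    also have "\<dots> \<le> fact n + Suc n" using step by simp
    also have "\<dots> \<le> fact n + n * fact n"
    proof -
      have "2 \<le> (fact n :: nat)" using fact_mono_nat[OF step(1)] by (simp add: fact_numeral)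
      then have "n * 2 \<le> n * fact n" by (rule mult_left_mono) simp
      then show ?thesis using step(1) by linarith
    qed
    finally show ?case by simp
  qed (simp add: fact_numeral)
  moreover have "q = 0 \<or> q = 1 \<or> q \<ge> 3" using that by linarith
  ultimately show ?thesis by auto
qed

lemma sparse_weights_mono: "q \<le> q' \<Longrightarrow> sparse_weights q \<subseteq> sparse_weights q'"
  by (auto simp: sparse_weights_def)

lemma attainable_mono: "q \<le> q' \<Longrightarrow> attainable d q v \<subseteq> attainable d q' v"
  using sparse_weights_mono[of q q'] unfolding attainable_def by blast

lemma attainable_on_subset: "0 \<notin> X \<Longrightarrow> attainable_on X d q v \<subseteq> attainable d q v"
  unfolding attainable_on_def attainable_def weights_on_def sparse_weights_def supp_def by blast

text \<open>
  An extra query at the point 1 reduces \<open>d + 1\<close> to \<open>d\<close>: dividing the weights by \<open>x - 1\<close> turns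
  moments into differences of consecutive moments, and the free weight at 1 fixes the first moment.
\<close>

lemma attainable_on_extra_query:
  fixes v :: "nat \<Rightarrow> 'f::{field,finite}"
  assumes X: "0 \<notin> X" "1 \<notin> X"
  shows "\<exists>v' :: nat \<Rightarrow> 'f. card (attainable_on X d q v) \<le> card (attainable (d + 1) (q + 1) v')"
proof -
  define v' where "v' k = (\<Sum>j\<in>{1..<k}. v j)" for k
  have "uminus ` attainable_on X d q v \<subseteq> attainable (d + 1) (q + 1) v'"
  proof (rule image_subsetI)
    fix \<gamma> assume "\<gamma> \<in> attainable_on X d q v"
    then obtain w where w: "\<gamma> = moment w 0" "supp w \<subseteq> X" "card (supp w) = q"
      "\<And>k. k \<in> {1..d} \<Longrightarrow> moment w k = v k"
      unfolding attainable_on_def weights_on_def by blast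
    define t where "t = - (\<Sum>x\<in>UNIV - {1}. w x / (x - 1) * x)"
    define u where "u x = (if x = 1 then t else w x / (x - 1))" for x
    have "w 1 = 0" using w(2) X by (auto simp: supp_def)
    have diff: "moment u (Suc k) - moment u k = moment w k" for k
    proof -
      have "moment u (Suc k) - moment u k = (\<Sum>x\<in>UNIV. u x * (x - 1) * x ^ k)"
        by (simp add: moment_def sum_subtractf[symmetric] algebra_simps)
      also have "\<dots> = (\<Sum>x\<in>UNIV. w x * x ^ k)"
        using \<open>w 1 = 0\<close> by (intro sum.cong) (auto simp: u_def)
      finally show ?thesis by (simp add: moment_def)
    qed
    have u1: "moment u 1 = 0"
      by (simp add: moment_def sum.remove[of UNIV 1] u_def t_def)
    have "moment u (Suc k) = v' (Suc k)" if "k \<le> d" for k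
      using that
    proof (induction k)
      case 0
      then show ?case using u1 by (simp add: v'_def)
    next
      case (Suc k)
      then have "moment u (Suc (Suc k)) = moment u (Suc k) + v (Suc k)"
        using diff[of "Suc k"] w(4)[of "Suc k"] by (simp add: algebra_simps)
      then show ?case using Suc by (simp add: v'_def)
    qed
    then have "\<forall>k\<in>{1..d + 1}. moment u k = v' k"
      by (metis Suc_eq_plus1 Suc_le_D Suc_le_mono atLeastAtMost_iff One_nat_def)
    moreover have "supp u \<subseteq> insert 1 (supp w)" by (auto simp: supp_def u_def)
    then have "card (supp u) \<le> q + 1"
      using w(3) card_mono[of "insert 1 (supp w)" "supp u"] card_insert_le_m1[of "q + 1" "supp w" 1] by simp
    then have "u \<in> sparse_weights (q + 1)"
      using w(2) X by (auto simp: sparse_weights_def u_def supp_def)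
    moreover have "moment u 0 = - \<gamma>" using diff[of 0] u1 w(1) by (simp add: eq_neg_iff_add_eq_0 algebra_simps)
    ultimately show "- \<gamma> \<in> attainable (d + 1) (q + 1) v'"
      unfolding attainable_def by (auto intro!: exI[of _ u])
  qed
  from card_mono[OF _ this] have "card (attainable_on X d q v) \<le> card (attainable (d + 1) (q + 1) v')"
    by (simp add: card_image)
  then show ?thesis by (rule exI[of _ v'])
qed

lemma max_attainable_even_ge:
  assumes d: "d = 2 * m" and q: "m + 1 \<le> q"
  shows "real CARD('f) - (fact (m + 1) + real d + 1) \<le> real (max_attainable TYPE('f::{field,finite}) d q)"
proof (cases "real CARD('f) \<le> fact (m + 1) + real d + 1")
  case False
  define N where "N = CARD('f) - 1"
  define f where "f = (fact (m + 1) :: real)"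
  have Q: "real CARD('f) = real N + 1" unfolding N_def by (simp add: of_nat_diff Suc_le_eq)
  have card: "card (UNIV - {0 :: 'f}) = N" by (simp add: N_def card_Diff_subset)
  have f: "f \<ge> 1" unfolding f_def by (rule fact_ge_1)
  have "real (m + 1) \<le> real N" using False d Q f unfolding f_def by simp
  then have mN: "m + 1 + 0 \<le> N" by simp
  define a where "a = real (N choose (m + 1))"
  define b where "b = real (N - (m + 1) choose (m + 1))"
  define e where "e = real N ^ m"
  have ab: "b \<le> a" unfolding a_def b_def by (simp add: binomial_right_mono)
  have e: "e \<ge> 0" by (simp add: e_def)
  have a: "real N * e - (real m + 1) * real m / 2 * e \<le> a * f"
    using binomial_times_fact_ge[OF mN] by (simp add: a_def f_def e_def add.commute)
  have "1 + m * (m + 1) div 2 \<le> fact (m + 1)"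
    using fact_ge_triangular[of "m + 1"] by (cases "m = 1") (auto simp: fact_numeral)
  then have "real (1 + m * (m + 1) div 2) \<le> real (fact (m + 1))" by (simp only: of_nat_le_iff)
  then have t: "1 + (real m + 1) * real m / 2 \<le> f"
    by (simp add: f_def real_of_nat_div algebra_simps)
  have "0 \<le> (a - b) * (real N + 1 - f)"
    using ab False Q by (intro mult_nonneg_nonneg) (auto simp: f_def)
  moreover have "0 \<le> e * (f - 1 - (real m + 1) * real m / 2)"
    using e t by (intro mult_nonneg_nonneg) auto
  ultimately have "(e + b) * (real N + 1 - f) \<le> a * (real N + 1)"
    using a by (simp add: algebra_simps)
  then have "(e + b) * (real CARD('f) - f) \<le> a * real CARD('f)" by (simp add: Q)
  then obtain v :: "nat \<Rightarrow> 'f" where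
    "real CARD('f) - (f + real d + 1) \<le> real (card (attainable_on (UNIV - {0}) d (m + 1) v))"
    using many_attainable_on[of "m + 1" d f "UNIV - {0 :: 'f}"] d f False Q
    unfolding card a_def b_def e_def f_def by auto
  moreover have "card (attainable_on (UNIV - {0}) d (m + 1) v) \<le> card (attainable d q v)"
    using attainable_on_subset[of "UNIV - {0 :: 'f}" d "m + 1" v] attainable_mono[OF q, of d v]
    by (intro card_mono) auto
  ultimately show ?thesis using card_attainable_le_max[of d q v] unfolding f_def by linarith
qed simp

lemma max_attainable_odd_ge:
  assumes d: "d = 2 * m + 1" and q: "m + 2 \<le> q"
  shows "real CARD('f) - (fact (m + 1) + real d + 1) \<le> real (max_attainable TYPE('f::{field,finite}) d q)"
proof (cases "real CARD('f) \<le> fact (m + 1) + real d + 1")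
  case False
  define N where "N = CARD('f) - 1"
  define f where "f = (fact (m + 1) :: real)"
  have Q: "real CARD('f) = real N + 1" unfolding N_def by (simp add: of_nat_diff Suc_le_eq)
  have card: "card (UNIV - {0 :: 'f, 1}) = N - 1" by (simp add: N_def card_Diff_subset)
  have f: "f \<ge> 1" unfolding f_def by (rule fact_ge_1)
  have "real (m + 1 + 1) \<le> real N" using False d Q f unfolding f_def by simp
  then have mN: "m + 1 + 1 \<le> N" by simp
  define a where "a = real (N - 1 choose (m + 1))"
  define b where "b = real (N - 1 - (m + 1) choose (m + 1))"
  define e where "e = real N ^ m"
  have ab: "b \<le> a" unfolding a_def b_def by (simp add: binomial_right_mono)
  have e: "e \<ge> 0" by (simp add: e_def)
  have a: "real N * e - ((real m + 1) + (real m + 1) * real m / 2) * e \<le> a * f"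
    using binomial_times_fact_ge[OF mN] by (simp add: a_def f_def e_def add.commute)
  have t: "0 \<le> a + e * (f - (real m + 1) - (real m + 1) * real m / 2)"
  proof (cases "m = 1")
    case True
    have "N \<ge> 6" using False Q unfolding d True by (simp add: fact_numeral)
    then have "2 * N \<le> (N - 1) * (N - 2)"
      using mult_le_mono2[of 4 "N - 2" "N - 1"] by linarith
    moreover have "N - 1 - 1 = N - 2" by simp
    ultimately have "N \<le> (N - 1) choose 2"
      unfolding choose_two using \<open>N - 1 - 1 = N - 2\<close> by simp
    then have "real N \<le> a" by (simp add: a_def True numeral_2_eq_2)
    then show ?thesis by (simp add: True e_def f_def fact_numeral)
  next
    case False
    then have "(m + 1) * (m + 1 + 1) div 2 \<le> fact (m + 1)" by (intro fact_ge_triangular) simp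
    then have "real ((m + 1) * (m + 1 + 1) div 2) \<le> real (fact (m + 1))" by (simp only: of_nat_le_iff)
    then have "(real m + 1) + (real m + 1) * real m / 2 \<le> f"
      by (simp add: f_def real_of_nat_div field_simps)
    then have "0 \<le> e * (f - (real m + 1) - (real m + 1) * real m / 2)"
      using e by (intro mult_nonneg_nonneg) auto
    then show ?thesis by (simp add: a_def)
  qed
  have "0 \<le> (a - b) * (real N - f)"
    using ab False Q by (intro mult_nonneg_nonneg) (auto simp: f_def)
  with t have "(e + b) * (real N + 1 - (f + 1)) \<le> a * (real N + 1)"
    using a by (simp add: algebra_simps)
  then have "(e + b) * (real CARD('f) - (f + 1)) \<le> a * real CARD('f)" by (simp add: Q)
  then obtain v :: "nat \<Rightarrow> 'f" where v:
    "real CARD('f) - (f + 1 + real (2 * m) + 1) \<le> real (card (attainable_on (UNIV - {0, 1}) (2 * m) (m + 1) v))"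
    using many_attainable_on[of "m + 1" "2 * m" "f + 1" "UNIV - {0 :: 'f, 1}"] d f False Q
    unfolding card a_def b_def e_def f_def by auto
  obtain v' :: "nat \<Rightarrow> 'f" where "card (attainable_on (UNIV - {0, 1}) (2 * m) (m + 1) v)
      \<le> card (attainable (2 * m + 1) (m + 1 + 1) v')"
    using attainable_on_extra_query[of "UNIV - {0, 1}" "2 * m" "m + 1" v] by auto
  also have "\<dots> \<le> card (attainable d q v')"
    using attainable_mono[of "m + 1 + 1" q d v'] q unfolding d by (intro card_mono) auto
  finally show ?thesis using v card_attainable_le_max[of d q v'] d unfolding f_def by simp
qed simp

lemma max_attainable_ge:
  assumes "d + 2 \<le> 2 * q"
  shows "real CARD('f) - (fact (d div 2 + 1) + real d + 1)
    \<le> real (max_attainable TYPE('f::{field,finite}) d q)"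
proof (cases "even d")
  case True
  with assms show ?thesis by (intro max_attainable_even_ge) auto
next
  case False
  with assms show ?thesis by (intro max_attainable_odd_ge) presburger+
qed

section \<open>Additive characters and the upper bound\<close>

locale additive_character =
  fixes e :: "'f::{field,finite} \<Rightarrow> complex"
  assumes add: "e (x + y) = e x * e y"
    and norm: "cmod (e x) = 1"
    and nontrivial: "\<exists>x. e x \<noteq> 1"
begin

lemma zero [simp]: "e 0 = 1"
proof -
  have "e 0 * e 0 = e 0 * 1" using add[of 0 0] by simp
  moreover have "e 0 \<noteq> 0" using norm[of 0] by auto
  ultimately show ?thesis by (simp only: mult_cancel_left) simp
qed

lemma cnj: "cnj (e x) = e (- x)"
proof -
  have "e x * e (- x) = 1" using add[of x "- x"] by simp
  moreover have "e x * cnj (e x) = 1"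
    using norm[of x] complex_norm_square[of "e x"] by simp
  moreover have "e x \<noteq> 0" using norm[of x] by auto
  ultimately show ?thesis by (metis mult_cancel_left)
qed

lemma sum_eq_0:
  assumes bij: "bij_betw f X X" and shift: "\<And>x. x \<in> X \<Longrightarrow> g (f x) = g x + c" and "e c \<noteq> 1"
  shows "(\<Sum>x\<in>X. e (g x)) = 0"
proof -
  have "(\<Sum>x\<in>X. e (g x)) = (\<Sum>x\<in>X. e (g (f x)))"
    using bij by (rule sum.reindex_bij_betw[symmetric])
  also have "\<dots> = (\<Sum>x\<in>X. e (g x)) * e c"
    by (simp add: shift add sum_distrib_right)
  finally have "(\<Sum>x\<in>X. e (g x)) * (e c - 1) = 0" by (simp add: algebra_simps)
  with \<open>e c \<noteq> 1\<close> show ?thesis by simp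
qed

lemma sum_mult: "(\<Sum>x\<in>UNIV. e (s * x)) = (if s = 0 then of_nat CARD('f) else 0)"
proof (cases "s = 0")
  case False
  obtain c where c: "e c \<noteq> 1" using nontrivial by blast
  have "bij_betw (\<lambda>x. x + c / s) UNIV UNIV"
    by (rule bij_betwI[where g = "\<lambda>x. x - c / s"]) auto
  then have "(\<Sum>x\<in>UNIV. e (s * x)) = 0"
    by (rule sum_eq_0[OF _ _ c]) (simp add: False distrib_left)
  then show ?thesis using False by simp
qed simp

end

lemma of_nat_inverse_finite_field:
  assumes "of_nat i \<noteq> (0 :: 'f::{field,finite})"
  obtains j where "of_nat j * of_nat i = (1 :: 'f)"
proof -
  have "card {0 :: 'f, 1} \<le> CARD('f)" by (intro card_mono) auto
  then have "CARD('f) - 1 = Suc (CARD('f) - 2)" by simp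
  then have "of_nat (i ^ (CARD('f) - 2)) * of_nat i = (of_nat i :: 'f) ^ (CARD('f) - 1)"
    by (simp add: mult.commute)
  also have "\<dots> = 1" using assms by (rule finite_field_power_card_minus_1)
  finally show ?thesis by (rule that)
qed

text \<open>
  An additive subgroup that is maximal among those avoiding 1 is a complement of the prime field;
  the character sends the residue \<open>j\<close> of \<open>x\<close> to \<open>\<omega> ^ j\<close> for a nontrivial root of unity \<open>\<omega>\<close>.
\<close>

lemma ex_additive_character: "\<exists>e :: 'f::{field,finite} \<Rightarrow> complex. additive_character e"
proof -
  let ?S = "{K :: 'f set. 0 \<in> K \<and> (\<forall>x\<in>K. \<forall>y\<in>K. x + y \<in> K) \<and> 1 \<notin> K}"
  have "{0} \<in> ?S" by auto
  then obtain K where K: "K \<in> ?S" and max: "\<And>K'. K' \<in> ?S \<Longrightarrow> K \<subseteq> K' \<Longrightarrow> K = K'"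
    using finite_has_maximal2[of ?S "{0}"] by auto
  have Kadd: "x + y \<in> K" if "x \<in> K" "y \<in> K" for x y using K that by blast
  have K0: "0 \<in> K" and K1: "1 \<notin> K" using K by blast+
  have Kmult: "of_nat j * x \<in> K" if "x \<in> K" for j x
    by (induction j) (use that K0 Kadd in \<open>auto simp: distrib_right\<close>)
  have p: "CHAR('f) > 1"
    using finite_imp_CHAR_pos[where 'a = 'f] CHAR_not_1'[where 'a = 'f] by (metis finite One_nat_def less_one linorder_neqE_nat less_irrefl)
  have minus: "- x = of_nat (CHAR('f) - 1) * x" for x :: 'f
  proof -
    have "x + of_nat (CHAR('f) - 1) * x = of_nat (Suc (CHAR('f) - 1)) * x" by (simp add: distrib_right)
    also have "Suc (CHAR('f) - 1) = CHAR('f)" using p by simp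
    finally show ?thesis by (intro minus_unique) simp
  qed
  have Kminus: "- x \<in> K" if "x \<in> K" for x
    unfolding minus using that by (rule Kmult)
  have unit: "of_nat i = (0 :: 'f)" if "of_nat i \<in> K" for i
  proof (rule ccontr)
    assume "of_nat i \<noteq> (0 :: 'f)"
    then obtain j where "of_nat j * of_nat i = (1 :: 'f)" by (rule of_nat_inverse_finite_field)
    then show False using Kmult[OF that, of j] K1 by simp
  qed
  have ex: "\<exists>j. x - of_nat j \<in> K" for x
  proof (cases "x \<in> K")
    case False
    let ?K' = "{k + of_nat i * x | k i. k \<in> K}"
    have sub: "K \<subseteq> ?K'"
    proof
      fix k assume "k \<in> K"
      then have "k = k + of_nat 0 * x \<and> k \<in> K" by simp
      then show "k \<in> ?K'" by blast
    qed
    have "x = 0 + of_nat 1 * x \<and> 0 \<in> K" using K0 by simp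
    then have x: "x \<in> ?K'" by blast
    have "a + b \<in> ?K'" if ab: "a \<in> ?K'" "b \<in> ?K'" for a b
    proof -
      obtain k i k' i' where "a = k + of_nat i * x" "b = k' + of_nat i' * x" "k \<in> K" "k' \<in> K"
        using ab by blast
      then have "a + b = (k + k') + of_nat (i + i') * x" "k + k' \<in> K"
        by (auto simp: algebra_simps Kadd)
      then show ?thesis by blast
    qed
    then have "1 \<in> ?K'" using max[of ?K'] sub x K0 False by blast
    then obtain k i where ki: "1 = k + of_nat i * x" "k \<in> K" by blast
    then have "of_nat i \<noteq> (0 :: 'f)" using K1 by auto
    then obtain j where j: "of_nat j * of_nat i = (1 :: 'f)" by (rule of_nat_inverse_finite_field)
    have "x = of_nat j * (of_nat i * x)" using j by (simp add: mult.assoc[symmetric])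
    also have "of_nat i * x = 1 - k" using ki by (simp add: algebra_simps)
    finally have "x - of_nat j = - (of_nat j * k)" by (simp add: algebra_simps)
    then show ?thesis using Kminus[OF Kmult[OF ki(2)], of j] by metis
  qed (auto intro!: exI[of _ 0])
  have "card {z :: complex. z ^ CHAR('f) = 1} = CHAR('f)"
    using p by (intro card_nth_roots) auto
  then have "\<not> {z :: complex. z ^ CHAR('f) = 1} \<subseteq> {1}"
    using p card_mono[of "{1 :: complex}" "{z :: complex. z ^ CHAR('f) = 1}"] by auto
  then obtain \<omega> :: complex where \<omega>: "\<omega> ^ CHAR('f) = 1" "\<omega> \<noteq> 1" by auto
  have "cmod \<omega> ^ CHAR('f) = 1 ^ CHAR('f)" using \<omega>(1) by (simp flip: norm_power)
  then have norm_\<omega>: "cmod \<omega> = 1"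
    using power_eq_imp_eq_base[of "cmod \<omega>" "CHAR('f)" 1] p by simp
  have cong: "\<omega> ^ j = \<omega> ^ j'" if "of_nat j - of_nat j' \<in> K" "j' \<le> j" for j j'
  proof -
    have "of_nat (j - j') = (0 :: 'f)" using unit[of "j - j'"] that by (simp add: of_nat_diff)
    then obtain r where "j - j' = CHAR('f) * r" by (auto simp: of_nat_eq_0_iff_char_dvd)
    then have "j = j' + CHAR('f) * r" using that by simp
    then show ?thesis using \<omega>(1) by (simp add: power_add power_mult)
  qed
  define h where "h x = (SOME j. x - of_nat j \<in> K)" for x :: 'f
  have h: "x - of_nat (h x) \<in> K" for x unfolding h_def using ex by (rule someI_ex)
  have h_eq: "\<omega> ^ h x = \<omega> ^ j" if "x - of_nat j \<in> K" for x j
  proof -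
    have "(x - of_nat j) + - (x - of_nat (h x)) \<in> K" by (intro Kadd Kminus that h)
    then have *: "of_nat (h x) - of_nat j \<in> K" by (simp add: algebra_simps)
    then have "- (of_nat (h x) - of_nat j) \<in> K" by (rule Kminus)
    then have "of_nat j - of_nat (h x) \<in> K" by simp
    with * show ?thesis using cong[of "h x" j] cong[of j "h x"] by (metis nat_le_linear)
  qed
  have "additive_character (\<lambda>x. \<omega> ^ h x)"
  proof
    fix x y
    have "(x - of_nat (h x)) + (y - of_nat (h y)) \<in> K" by (intro Kadd h)
    then have "(x + y) - of_nat (h x + h y) \<in> K" by (simp add: algebra_simps)
    then show "\<omega> ^ h (x + y) = \<omega> ^ h x * \<omega> ^ h y"
      unfolding power_add[symmetric] by (rule h_eq)
    show "cmod (\<omega> ^ h x) = 1" by (simp add: norm_power norm_\<omega>)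
    have "\<omega> ^ h 1 = \<omega> ^ 1" using K0 by (intro h_eq) simp
    then show "\<exists>x. \<omega> ^ h x \<noteq> 1" using \<omega>(2) by (intro exI[of _ 1]) simp
  qed
  then show ?thesis by blast
qed

definition bform :: "nat \<Rightarrow> ('f::zero) operator \<Rightarrow> 'f state \<Rightarrow> 'f state \<Rightarrow> complex" where
  "bform w M \<phi> \<psi> = (\<Sum>i\<in>basis w. cnj (\<phi> i) * apply_op w M \<psi> i)"

definition id_op :: "'f operator" where
  "id_op = (\<lambda>i j. if i = j then 1 else 0)"

lemma form_eq_bform: "form w M \<psi> = bform w M \<psi> \<psi>"
  by (simp add: form_def bform_def)

lemma finite_basis [simp]: "finite (basis w :: ('f::{zero,finite}) index set)"
  by (simp add: basis_def)

lemma bform_sum_right: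
  "bform w M \<phi> (\<lambda>i. \<Sum>s\<in>S. b s * \<psi> s i) = (\<Sum>s\<in>S. b s * bform w M \<phi> (\<psi> s))"
proof -
  have "bform w M \<phi> (\<lambda>i. \<Sum>s\<in>S. b s * \<psi> s i) =
      (\<Sum>i\<in>basis w. \<Sum>j\<in>basis w. \<Sum>s\<in>S. b s * (cnj (\<phi> i) * (M i j * \<psi> s j)))"
    by (simp add: bform_def apply_op_def sum_distrib_left mult_ac)
  also have "\<dots> = (\<Sum>i\<in>basis w. \<Sum>s\<in>S. \<Sum>j\<in>basis w. b s * (cnj (\<phi> i) * (M i j * \<psi> s j)))"
    by (intro sum.cong refl sum.swap)
  also have "\<dots> = (\<Sum>s\<in>S. \<Sum>i\<in>basis w. \<Sum>j\<in>basis w. b s * (cnj (\<phi> i) * (M i j * \<psi> s j)))"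
    by (rule sum.swap)
  finally show ?thesis by (simp add: bform_def apply_op_def sum_distrib_left)
qed

lemma bform_sum_left:
  "bform w M (\<lambda>i. \<Sum>s\<in>S. b s * \<phi> s i) \<psi> = (\<Sum>s\<in>S. cnj (b s) * bform w M (\<phi> s) \<psi>)"
proof -
  have "bform w M (\<lambda>i. \<Sum>s\<in>S. b s * \<phi> s i) \<psi> =
      (\<Sum>i\<in>basis w. \<Sum>s\<in>S. cnj (b s) * (cnj (\<phi> s i) * apply_op w M \<psi> i))"
    by (simp add: bform_def sum_distrib_right sum_distrib_left mult_ac)
  also have "\<dots> = (\<Sum>s\<in>S. \<Sum>i\<in>basis w. cnj (b s) * (cnj (\<phi> s i) * apply_op w M \<psi> i))"
    by (rule sum.swap)
  finally show ?thesis by (simp add: bform_def sum_distrib_left)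
qed

lemma form_sum:
  fixes S :: "'s set"
  shows "form w M (\<lambda>i. \<Sum>s\<in>S. b s * \<psi> s i) =
    (\<Sum>s\<in>S. \<Sum>t\<in>S. cnj (b s) * b t * bform w M (\<psi> s) (\<psi> t))"
  by (simp add: form_eq_bform bform_sum_left bform_sum_right sum_distrib_left mult.assoc)

lemma form_scale:
  assumes "cmod c = 1"
  shows "form w M (\<lambda>i. c * \<psi> i) = form w M \<psi>"
proof -
  have "cnj c * c = 1" using assms complex_norm_square[of c] by (simp add: mult.commute)
  then show ?thesis using form_sum[where S = "{()}" and w = w and M = M and b = "\<lambda>_. c" and \<psi> = "\<lambda>_. \<psi>"] by (simp add: form_eq_bform)
qed

lemma form_diff:
  "form w M (\<lambda>i. \<phi> i - \<psi> i) =
    form w M \<phi> + form w M \<psi> - bform w M \<phi> \<psi> - bform w M \<psi> \<phi>"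
  using form_sum[where S = UNIV and w = w and M = M and b = "\<lambda>b. if b then 1 else - 1" and \<psi> = "\<lambda>b. if b then \<phi> else \<psi>"]
  by (simp add: UNIV_bool form_eq_bform algebra_simps)

lemma form_cong: "(\<And>i. i \<in> basis w \<Longrightarrow> \<phi> i = \<psi> i) \<Longrightarrow> form w M \<phi> = form w M \<psi>"
  by (simp add: form_def apply_op_def)

lemma form_id_op:
  fixes \<psi> :: "('f::{zero,finite}) state"
  shows "form w id_op \<psi> = of_real (\<Sum>i\<in>basis w. (cmod (\<psi> i))\<^sup>2)"
proof -
  have "form w id_op \<psi> = (\<Sum>i\<in>basis w. cnj (\<psi> i) * (\<Sum>j\<in>basis w. if i = j then \<psi> j else 0))"
    by (simp add: form_def apply_op_def id_op_def if_distrib[of "\<lambda>c. c * _"] cong: if_cong)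
  then show ?thesis by (simp add: complex_norm_square mult.commute del: of_real_power)
qed

lemma sum_form_povm:
  assumes "povm w E"
  shows "(\<Sum>a\<in>UNIV. form w (E a) \<psi>) = form w id_op \<psi>"
proof -
  have "(\<Sum>a\<in>UNIV. form w (E a) \<psi>) =
      (\<Sum>i\<in>basis w. \<Sum>a\<in>UNIV. \<Sum>j\<in>basis w. cnj (\<psi> i) * (E a i j * \<psi> j))"
    unfolding form_def apply_op_def sum_distrib_left by (rule sum.swap)
  also have "\<dots> = (\<Sum>i\<in>basis w. \<Sum>j\<in>basis w. \<Sum>a\<in>UNIV. cnj (\<psi> i) * (E a i j * \<psi> j))"
    by (intro sum.cong refl sum.swap)
  also have "\<dots> = (\<Sum>i\<in>basis w. \<Sum>j\<in>basis w. cnj (\<psi> i) * ((\<Sum>a\<in>UNIV. E a i j) * \<psi> j))"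
    by (simp add: sum_distrib_left sum_distrib_right)
  also have "\<dots> = (\<Sum>i\<in>basis w. \<Sum>j\<in>basis w. cnj (\<psi> i) * (id_op i j * \<psi> j))"
    using assms by (intro sum.cong refl) (simp add: povm_def id_op_def)
  finally show ?thesis by (simp add: form_def apply_op_def sum_distrib_left)
qed

lemma form_sum_le:
  assumes pos: "\<And>\<psi>. form w M \<psi> \<in> \<real>\<^sub>\<ge>\<^sub>0"
  shows "Re (form w M (\<lambda>i. \<Sum>s\<in>S. \<psi> s i)) \<le> real (card S) * (\<Sum>s\<in>S. Re (form w M (\<psi> s)))"
proof -
  let ?b = "\<lambda>s t. Re (bform w M (\<psi> s) (\<psi> t))"
  have "0 \<le> (\<Sum>s\<in>S. \<Sum>t\<in>S. Re (form w M (\<lambda>i. \<psi> s i - \<psi> t i)))"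
    using pos by (intro sum_nonneg) (auto simp: complex_nonneg_Reals_iff)
  also have "\<dots> = (\<Sum>s\<in>S. \<Sum>t\<in>S. ?b s s) + (\<Sum>s\<in>S. \<Sum>t\<in>S. ?b t t)
      - (\<Sum>s\<in>S. \<Sum>t\<in>S. ?b s t) - (\<Sum>s\<in>S. \<Sum>t\<in>S. ?b t s)"
    by (simp add: form_diff form_eq_bform sum.distrib sum_subtractf)
  also have "(\<Sum>s\<in>S. \<Sum>t\<in>S. ?b t s) = (\<Sum>s\<in>S. \<Sum>t\<in>S. ?b s t)" by (rule sum.swap)
  also have "(\<Sum>s\<in>S. \<Sum>t\<in>S. ?b s t) = Re (form w M (\<lambda>i. \<Sum>s\<in>S. \<psi> s i))"
    using form_sum[where S = S and w = w and M = M and b = "\<lambda>_. 1" and \<psi> = \<psi>] by simp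
  finally show ?thesis by (simp add: form_eq_bform flip: sum_distrib_left)
qed

lemma sum_form_orthogonal:
  assumes "finite T" and orth: "\<And>s t. s \<in> T \<Longrightarrow> t \<in> T \<Longrightarrow>
    (\<Sum>x\<in>X. cnj (\<theta> s x) * \<theta> t x) = (if s = t then c else 0)"
  shows "(\<Sum>x\<in>X. form w M (\<lambda>i. \<Sum>t\<in>T. \<theta> t x * \<psi> t i)) = c * (\<Sum>t\<in>T. form w M (\<psi> t))"
proof -
  have "(\<Sum>x\<in>X. form w M (\<lambda>i. \<Sum>t\<in>T. \<theta> t x * \<psi> t i)) =
      (\<Sum>x\<in>X. \<Sum>s\<in>T. \<Sum>t\<in>T. cnj (\<theta> s x) * \<theta> t x * bform w M (\<psi> s) (\<psi> t))"
    by (simp add: form_sum)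
  also have "\<dots> = (\<Sum>s\<in>T. \<Sum>x\<in>X. \<Sum>t\<in>T. cnj (\<theta> s x) * \<theta> t x * bform w M (\<psi> s) (\<psi> t))"
    by (rule sum.swap)
  also have "\<dots> = (\<Sum>s\<in>T. \<Sum>t\<in>T. \<Sum>x\<in>X. cnj (\<theta> s x) * \<theta> t x * bform w M (\<psi> s) (\<psi> t))"
    by (intro sum.cong refl sum.swap)
  also have "\<dots> = (\<Sum>s\<in>T. \<Sum>t\<in>T. (if s = t then c * bform w M (\<psi> s) (\<psi> t) else 0))"
    using orth by (intro sum.cong refl) (simp add: sum_distrib_right[symmetric])
  also have "\<dots> = (\<Sum>s\<in>T. c * form w M (\<psi> s))"
    using \<open>finite T\<close> by (simp add: form_eq_bform)
  finally show ?thesis by (simp add: sum_distrib_left)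
qed

lemma apply_query_op:
  fixes A :: "('f::{field,finite}) poly"
  assumes "(x, y, z) \<in> basis w"
  shows "apply_op w (query_op A) \<psi> (x, y, z) = \<psi> (x, y - poly A x, z)"
proof -
  have "query_op A (x, y, z) j = (if j = (x, y - poly A x, z) then 1 else 0)" for j
    by (cases j) (auto simp: query_op_def)
  then have "apply_op w (query_op A) \<psi> (x, y, z) =
      (\<Sum>j\<in>basis w. if j = (x, y - poly A x, z) then \<psi> j else 0)"
    unfolding apply_op_def by (intro sum.cong refl) simp
  then show ?thesis using assms by (simp add: basis_def)
qed

lemma form_id_op_apply_query_op:
  fixes A :: "('f::{field,finite}) poly"
  shows "form w id_op (apply_op w (query_op A) \<psi>) = form w id_op \<psi>"
proof -
  have "(\<Sum>i\<in>basis w. (cmod (apply_op w (query_op A) \<psi> i))\<^sup>2) = (\<Sum>i\<in>basis w. (cmod (\<psi> i))\<^sup>2)"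
    by (rule sum.reindex_bij_witness[of _ "\<lambda>(x, y, z). (x, y + poly A x, z)" "\<lambda>(x, y, z). (x, y - poly A x, z)"])
      (auto simp: apply_query_op, auto simp: basis_def)
  then show ?thesis by (simp add: form_id_op)
qed

lemma form_id_op_apply_unitary_op:
  fixes \<psi> :: "('f::{zero,finite}) state"
  assumes "unitary_op w U"
  shows "form w id_op (apply_op w U \<psi>) = form w id_op \<psi>"
proof -
  have "form w id_op (apply_op w U \<psi>) = (\<Sum>k\<in>basis w. cnj (apply_op w U \<psi> k) * apply_op w U \<psi> k)"
    by (simp add: form_id_op complex_norm_square mult.commute del: of_real_power)
  also have "\<dots> = (\<Sum>k\<in>basis w. \<Sum>i\<in>basis w. \<Sum>j\<in>basis w. cnj (\<psi> i) * \<psi> j * (cnj (U k i) * U k j))"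
    by (simp add: apply_op_def sum_product) (simp only: mult_ac)
  also have "\<dots> = (\<Sum>i\<in>basis w. \<Sum>k\<in>basis w. \<Sum>j\<in>basis w. cnj (\<psi> i) * \<psi> j * (cnj (U k i) * U k j))"
    by (rule sum.swap)
  also have "\<dots> = (\<Sum>i\<in>basis w. \<Sum>j\<in>basis w. \<Sum>k\<in>basis w. cnj (\<psi> i) * \<psi> j * (cnj (U k i) * U k j))"
    by (intro sum.cong refl sum.swap)
  also have "\<dots> = (\<Sum>i\<in>basis w. \<Sum>j\<in>basis w. cnj (\<psi> i) * \<psi> j * (\<Sum>k\<in>basis w. cnj (U k i) * U k j))"
    by (simp only: sum_distrib_left)
  also have "\<dots> = (\<Sum>i\<in>basis w. \<Sum>j\<in>basis w. cnj (\<psi> i) * (id_op i j * \<psi> j))"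
    using assms by (intro sum.cong refl) (simp add: unitary_op_def id_op_def)
  finally show ?thesis by (simp add: form_def apply_op_def sum_distrib_left)
qed

lemma form_id_op_final_state:
  fixes alg :: "('f::{field,finite}) query_algorithm"
  assumes "is_query_algorithm q alg"
  shows "form (workdim alg) id_op (final_state alg A) = 1"
proof -
  let ?w = "workdim alg"
  have "form ?w id_op (foldl (\<lambda>\<psi> U. apply_op ?w U (apply_op ?w (query_op A) \<psi>)) \<psi> Us) = form ?w id_op \<psi>"
    if "\<forall>U\<in>set Us. unitary_op ?w U" for Us \<psi>
    using that
    by (induction Us arbitrary: \<psi>)
      (simp_all add: form_id_op_apply_unitary_op form_id_op_apply_query_op)
  moreover have "form ?w id_op (init alg) = 1"
    using assms by (simp add: is_query_algorithm_def form_id_op unit_state_def)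
  ultimately show ?thesis
    using assms by (simp add: final_state_def is_query_algorithm_def)
qed

lemma finite_degree_le [simp]: "finite {A :: 'f::{field,finite} poly. degree A \<le> d}"
proof (rule inj_on_finite[where B = "PiE {..d} (\<lambda>_. UNIV)"])
  show "inj_on (\<lambda>A :: 'f poly. restrict (coeff A) {..d}) {A. degree A \<le> d}"
  proof (rule inj_onI)
    fix A B :: "'f poly"
    assume AB: "A \<in> {A. degree A \<le> d}" "B \<in> {A. degree A \<le> d}"
      and eq: "restrict (coeff A) {..d} = restrict (coeff B) {..d}"
    have "coeff A k = coeff B k" for k
    proof (cases "k \<le> d")
      case True
      then show ?thesis using fun_cong[OF eq, of k] by (simp only: restrict_apply atMost_iff if_True)
    next
      case False
      then show ?thesis using AB by (simp add: coeff_eq_0)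
    qed
    then show "A = B" by (simp add: poly_eq_iff)
  qed
  show "(\<lambda>A :: 'f poly. restrict (coeff A) {..d}) ` {A. degree A \<le> d} \<subseteq> PiE {..d} (\<lambda>_. UNIV)"
    by (rule image_subsetI) simp
qed (simp add: finite_PiE)

lemma card_degree_le_pos: "card {A :: 'f::{field,finite} poly. degree A \<le> d} > 0"
proof -
  have "0 \<in> {A :: 'f poly. degree A \<le> d}" by simp
  then show ?thesis by (simp only: card_gt_0_iff finite_degree_le) blast
qed

context additive_character
begin

lemma fourier_inversion:
  "g y = (\<Sum>s\<in>UNIV. e (s * y) * ((\<Sum>t\<in>UNIV. g t * e (- (s * t))) / of_nat CARD('f)))"
proof -
  have "(\<Sum>s\<in>UNIV. e (s * y) * (\<Sum>t\<in>UNIV. g t * e (- (s * t)))) =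
      (\<Sum>s\<in>UNIV. \<Sum>t\<in>UNIV. g t * e ((y - t) * s))"
    by (simp add: sum_distrib_left algebra_simps flip: add)
  also have "\<dots> = (\<Sum>t\<in>UNIV. \<Sum>s\<in>UNIV. g t * e ((y - t) * s))" by (rule sum.swap)
  also have "\<dots> = (\<Sum>t\<in>UNIV. if t = y then g y * of_nat CARD('f) else 0)"
    by (intro sum.cong refl) (simp add: sum_mult flip: sum_distrib_left)
  finally show ?thesis by (simp add: sum_divide_distrib[symmetric])
qed

text \<open>
  The Fourier transform of the response register turns a query at \<open>x\<close> into multiplication by the
  characters \<open>A \<mapsto> e (- s * A x)\<close>, so each query changes the weight at one point.
\<close>

lemma state_expansion:
  "\<exists>\<phi>. \<forall>A. \<forall>i\<in>basis w.
    foldl (\<lambda>\<psi> U. apply_op w U (apply_op w (query_op A) \<psi>)) \<psi> Us i =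
      (\<Sum>u\<in>sparse_weights (length Us). e (\<Sum>x\<in>UNIV. u x * poly A x) * \<phi> u i)"
proof (induction Us rule: rev_induct)
  case Nil
  have "sparse_weights 0 = {\<lambda>_ :: 'f. 0 :: 'f}"
    by (auto simp: sparse_weights_def supp_def)
  then show ?case by (intro exI[of _ "\<lambda>_. \<psi>"]) simp
next
  case (snoc U Us)
  let ?q = "length Us"
  let ?W = "sparse_weights ?q :: ('f \<Rightarrow> 'f) set" and ?W' = "sparse_weights (?q + 1) :: ('f \<Rightarrow> 'f) set"
  let ?e = "\<lambda>u A. e (\<Sum>x\<in>UNIV. u x * poly A x)"
  define state where "state A = foldl (\<lambda>\<psi> U. apply_op w U (apply_op w (query_op A) \<psi>)) \<psi> Us" for A
  obtain \<phi> where \<phi>: "\<And>A i. i \<in> basis w \<Longrightarrow> state A i = (\<Sum>u\<in>?W. ?e u A * \<phi> u i)"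
    using snoc unfolding state_def by blast
  define hat where "hat u x s z = (\<Sum>t\<in>UNIV. \<phi> u (x, t, z) * e (- (s * t))) / of_nat CARD('f)" for u x s z
  define sh where "sh x = (\<lambda>(u :: 'f \<Rightarrow> 'f, s). u(x := u x - s))" for x
  define \<phi>' where "\<phi>' u' = (\<lambda>(x, y, z). \<Sum>p\<in>{p \<in> ?W \<times> UNIV. sh x p = u'}. e (snd p * y) * hat (fst p) x (snd p) z)" for u'
  have "apply_op w (query_op A) (state A) i = (\<Sum>u'\<in>?W'. ?e u' A * \<phi>' u' i)" if "i \<in> basis w" for A i
  proof -
    obtain x y z where i: "i = (x, y, z)" by (cases i) auto
    have x: "x \<noteq> 0" and b: "(x, y - poly A x, z) \<in> basis w" using that by (auto simp: i basis_def)
    have sub: "sh x ` (?W \<times> UNIV) \<subseteq> ?W'"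
    proof (rule image_subsetI)
      fix p assume "p \<in> ?W \<times> (UNIV :: 'f set)"
      then obtain u s where p: "p = (u, s)" "u \<in> ?W" by auto
      have "card (supp (u(x := u x - s))) \<le> card (insert x (supp u))"
        by (intro card_mono) (auto simp: supp_def)
      also have "\<dots> \<le> card (supp u) + 1" by (simp add: card_insert_if)
      finally show "sh x p \<in> ?W'" using p x by (auto simp: sh_def sparse_weights_def)
    qed
    have ph: "?e (sh x p) A = ?e (fst p) A * e (- (snd p * poly A x))" for p
    proof -
      have "(\<Sum>x'\<in>UNIV. sh x p x' * poly A x') =
          (\<Sum>x'\<in>UNIV. fst p x' * poly A x' + (if x' = x then - (snd p * poly A x) else 0))"
        by (intro sum.cong refl) (auto simp: sh_def algebra_simps split: prod.split)
      then show ?thesis by (simp add: sum.distrib flip: add)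
    qed
    have "apply_op w (query_op A) (state A) i = (\<Sum>u\<in>?W. ?e u A * \<phi> u (x, y - poly A x, z))"
      unfolding i using b by (subst apply_query_op) (use that in \<open>simp_all add: \<phi> i\<close>)
    also have "\<dots> = (\<Sum>u\<in>?W. ?e u A * (\<Sum>s\<in>UNIV. e (s * (y - poly A x)) * hat u x s z))"
      unfolding hat_def by (subst fourier_inversion[of "\<lambda>y. \<phi> _ (x, y, z)"]) simp
    also have "\<dots> = (\<Sum>u\<in>?W. \<Sum>s\<in>UNIV. ?e (sh x (u, s)) A * (e (s * y) * hat u x s z))"
    proof -
      have "e (s * (y - poly A x)) = e (s * y) * e (- (s * poly A x))" for s
        by (simp add: algebra_simps flip: add)
      then have "?e u A * (e (s * (y - poly A x)) * hat u x s z) = ?e (sh x (u, s)) A * (e (s * y) * hat u x s z)" for u s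
        unfolding ph by simp
      then show ?thesis by (simp only: sum_distrib_left)
    qed
    also have "\<dots> = (\<Sum>p\<in>?W \<times> UNIV. ?e (sh x p) A * (e (snd p * y) * hat (fst p) x (snd p) z))"
      by (simp add: sum.cartesian_product case_prod_beta)
    also have "\<dots> = (\<Sum>u'\<in>?W'. \<Sum>p\<in>{p \<in> ?W \<times> UNIV. sh x p = u'}.
        ?e (sh x p) A * (e (snd p * y) * hat (fst p) x (snd p) z))"
      by (rule sum.group[OF _ _ sub, symmetric]) auto
    also have "\<dots> = (\<Sum>u'\<in>?W'. ?e u' A * \<phi>' u' i)"
      by (simp add: i \<phi>'_def sum_distrib_left)
    finally show ?thesis .
  qed
  then have "apply_op w U (apply_op w (query_op A) (state A)) i =
      (\<Sum>u'\<in>?W'. ?e u' A * (\<Sum>j\<in>basis w. U i j * \<phi>' u' j))" for A i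
    unfolding apply_op_def[of w U]
    by (simp add: sum_distrib_left mult_ac) (rule sum.swap)
  then show ?case
    by (intro exI[of _ "\<lambda>u' i. \<Sum>j\<in>basis w. U i j * \<phi>' u' j"]) (simp add: state_def)
qed

lemma fibre_orthogonality:
  fixes a :: 'f
  assumes v: "v \<in> PiE {1..d} (\<lambda>_. UNIV)" "v' \<in> PiE {1..d} (\<lambda>_. UNIV)"
  defines "\<theta> \<equiv> \<lambda>v A. e (\<Sum>k\<in>{1..d}. v k * coeff A k)"
  shows "(\<Sum>A | degree A \<le> d \<and> coeff A 0 = a. cnj (\<theta> v A) * \<theta> v' A) =
    (if v = v' then of_nat (card {A :: 'f poly. degree A \<le> d \<and> coeff A 0 = 0}) else 0)"
proof -
  let ?H = "\<lambda>a. {A :: 'f poly. degree A \<le> d \<and> coeff A 0 = a}"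
  have eq: "(\<Sum>A\<in>?H a. cnj (\<theta> v A) * \<theta> v' A) =
      (\<Sum>A\<in>?H a. e (\<Sum>k\<in>{1..d}. (v' k - v k) * coeff A k))"
    by (simp add: \<theta>_def cnj left_diff_distrib sum_subtractf flip: add)
  show ?thesis
  proof (cases "v = v'")
    case True
    have "bij_betw (\<lambda>A. A + [:a:]) (?H 0) (?H a)"
      by (rule bij_betwI[where g = "\<lambda>A. A - [:a:]"]) (auto intro!: degree_add_le degree_diff_le)
    then have "card (?H 0) = card (?H a)" by (rule bij_betw_same_card)
    then show ?thesis unfolding eq using True by simp
  next
    case False
    then obtain k where k: "k \<in> {1..d}" "v k \<noteq> v' k" using PiE_ext[OF v] by blast
    obtain c where c: "e c \<noteq> 1" using nontrivial by blast
    let ?m = "monom (c / (v' k - v k)) k"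
    have deg: "degree ?m \<le> d" using degree_monom_le[of "c / (v' k - v k)" k] k by simp
    have "bij_betw (\<lambda>A. A + ?m) (?H a) (?H a)"
      using k(1) deg
      by (intro bij_betwI[where g = "\<lambda>A. A - ?m"]) (auto intro!: degree_add_le degree_diff_le)
    then have "(\<Sum>A\<in>?H a. e (\<Sum>k\<in>{1..d}. (v' k - v k) * coeff A k)) = 0"
    proof (rule sum_eq_0[OF _ _ c])
      fix A
      have "(\<Sum>j\<in>{1..d}. (v' j - v j) * coeff (A + ?m) j) =
          (\<Sum>j\<in>{1..d}. (v' j - v j) * coeff A j) + (\<Sum>j\<in>{1..d}. if j = k then c else 0)"
        unfolding sum.distrib[symmetric] using k by (intro sum.cong refl) (auto simp: distrib_left)
      then show "(\<Sum>j\<in>{1..d}. (v' j - v j) * coeff (A + ?m) j) =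
          (\<Sum>j\<in>{1..d}. (v' j - v j) * coeff A j) + c"
        using k by simp
    qed
    then show ?thesis unfolding eq using False by simp
  qed
qed

theorem success_prob_le:
  fixes alg :: "'f query_algorithm"
  assumes alg: "is_query_algorithm q alg"
  shows "success_prob d alg \<le> real (max_attainable TYPE('f) d q) / real CARD('f)"
proof -
  define w where "w = workdim alg"
  define \<psi> where "\<psi> = final_state alg"
  define E where "E = meas alg"
  define V where "V = PiE {1..d} (\<lambda>_. UNIV :: 'f set)"
  define N where "N = max_attainable TYPE('f) d q"
  let ?att = "attainable d q :: (nat \<Rightarrow> 'f) \<Rightarrow> 'f set"
  let ?W = "sparse_weights q :: ('f \<Rightarrow> 'f) set"
  let ?H = "\<lambda>a. {A :: 'f poly. degree A \<le> d \<and> coeff A 0 = a}"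
  have povm: "povm w E" and len: "length (gates alg) = q"
    using alg by (auto simp: is_query_algorithm_def w_def E_def)
  obtain \<phi> where \<phi>: "\<psi> A i = (\<Sum>u\<in>?W. e (\<Sum>x\<in>UNIV. u x * poly A x) * \<phi> u i)" if "i \<in> basis w" for A i
    using state_expansion[of w "init alg" "gates alg"] unfolding \<psi>_def w_def final_state_def len by blast
  define key where "key u = (restrict (moment u) {1..d}, moment u 0)" for u :: "'f \<Rightarrow> 'f"
  define \<Phi> where "\<Phi> v \<gamma> i = (\<Sum>u\<in>{u \<in> ?W. key u = (v, \<gamma>)}. \<phi> u i)" for v \<gamma> i
  define \<Psi> where "\<Psi> v a i = (\<Sum>\<gamma>\<in>?att v. e (\<gamma> * a) * \<Phi> v \<gamma> i)" for v a i
  define \<theta> where "\<theta> v A = e (\<Sum>k\<in>{1..d}. v k * coeff A k)" for v A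
  define h where "h = real (card (?H 0))"
  have finV: "finite V" unfolding V_def by (intro finite_PiE) auto
  have expansion: "\<psi> A i = (\<Sum>v\<in>V. \<theta> v A * \<Psi> v (coeff A 0) i)" if A: "degree A \<le> d" and i: "i \<in> basis w" for A i
  proof -
    have sub: "key ` ?W \<subseteq> Sigma V ?att"
      unfolding key_def V_def attainable_def by auto
    have ph: "e (\<Sum>x\<in>UNIV. u x * poly A x) = \<theta> (fst (key u)) A * e (snd (key u) * coeff A 0)" for u
    proof -
      have "{..d} = insert 0 {1..d}" by auto
      then show ?thesis unfolding sum_weight_poly[OF A] \<theta>_def key_def
        by (simp add: mult.commute flip: add)
    qed
    have "\<psi> A i = (\<Sum>u\<in>?W. \<theta> (fst (key u)) A * e (snd (key u) * coeff A 0) * \<phi> u i)"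
      unfolding \<phi>[OF i] ph ..
    also have "\<dots> = (\<Sum>p\<in>Sigma V ?att. \<Sum>u\<in>{u \<in> ?W. key u = p}.
        \<theta> (fst (key u)) A * e (snd (key u) * coeff A 0) * \<phi> u i)"
      using finV by (intro sum.group[OF _ _ sub, symmetric] finite_SigmaI) auto
    also have "\<dots> = (\<Sum>p\<in>Sigma V ?att. \<theta> (fst p) A * (e (snd p * coeff A 0) * \<Phi> (fst p) (snd p) i))"
      by (simp add: \<Phi>_def sum_distrib_left mult.assoc)
    also have "\<dots> = (\<Sum>v\<in>V. \<Sum>\<gamma>\<in>?att v. \<theta> v A * (e (\<gamma> * coeff A 0) * \<Phi> v \<gamma> i))"
      using finV by (subst sum.Sigma) (auto simp: case_prod_beta)
    finally show ?thesis by (simp add: \<Psi>_def sum_distrib_left)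
  qed
  have fibre: "(\<Sum>A\<in>?H a. Re (form w M (\<psi> A))) = h * (\<Sum>v\<in>V. Re (form w M (\<Psi> v a)))" for M a
  proof -
    have "(\<Sum>A\<in>?H a. form w M (\<psi> A)) = (\<Sum>A\<in>?H a. form w M (\<lambda>i. \<Sum>v\<in>V. \<theta> v A * \<Psi> v a i))"
      by (intro sum.cong refl form_cong) (auto simp: expansion)
    also have "\<dots> = of_nat (card (?H 0)) * (\<Sum>v\<in>V. form w M (\<Psi> v a))"
      using finV unfolding V_def \<theta>_def
      by (intro sum_form_orthogonal fibre_orthogonality)
    finally have "Re (\<Sum>A\<in>?H a. form w M (\<psi> A)) = Re (of_nat (card (?H 0)) * (\<Sum>v\<in>V. form w M (\<Psi> v a)))"
      by simp
    then show ?thesis by (simp add: h_def)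
  qed
  have split: "(\<Sum>A | degree A \<le> d. F A) = (\<Sum>a\<in>UNIV. \<Sum>A\<in>?H a. F A)" for F :: "'f poly \<Rightarrow> real"
    using sum.group[of "{A :: 'f poly. degree A \<le> d}" UNIV "\<lambda>A. coeff A 0" F] by simp
  define B where "B = (\<Sum>v\<in>V. \<Sum>\<gamma>\<in>?att v. Re (form w id_op (\<Phi> v \<gamma>)))"
  have norm_\<Psi>: "(\<Sum>a\<in>UNIV. Re (form w id_op (\<Psi> v a))) = real CARD('f) * (\<Sum>\<gamma>\<in>?att v. Re (form w id_op (\<Phi> v \<gamma>)))" for v
  proof -
    have "(\<Sum>a\<in>UNIV. form w id_op (\<Psi> v a)) = of_nat CARD('f) * (\<Sum>\<gamma>\<in>?att v. form w id_op (\<Phi> v \<gamma>))"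
      unfolding \<Psi>_def
    proof (rule sum_form_orthogonal)
      fix \<gamma> \<gamma>'
      have "(\<Sum>a\<in>UNIV. cnj (e (\<gamma> * a)) * e (\<gamma>' * a)) = (\<Sum>a\<in>UNIV. e ((\<gamma>' - \<gamma>) * a))"
        by (simp add: cnj left_diff_distrib flip: add)
      then show "(\<Sum>a\<in>UNIV. cnj (e (\<gamma> * a)) * e (\<gamma>' * a)) = (if \<gamma> = \<gamma>' then of_nat CARD('f) else 0)"
        by (simp add: sum_mult)
    qed simp
    then have "Re (\<Sum>a\<in>UNIV. form w id_op (\<Psi> v a)) = Re (of_nat CARD('f) * (\<Sum>\<gamma>\<in>?att v. form w id_op (\<Phi> v \<gamma>)))"
      by simp
    then show ?thesis by simp
  qed
  have "real (card {A :: 'f poly. degree A \<le> d}) = (\<Sum>A | degree A \<le> d. Re (form w id_op (\<psi> A)))"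
    unfolding w_def \<psi>_def form_id_op_final_state[OF alg] by simp
  also have "\<dots> = (\<Sum>a\<in>UNIV. h * (\<Sum>v\<in>V. Re (form w id_op (\<Psi> v a))))"
    unfolding split fibre ..
  also have "\<dots> = h * (\<Sum>v\<in>V. \<Sum>a\<in>UNIV. Re (form w id_op (\<Psi> v a)))"
    by (subst sum.swap) (simp add: sum_distrib_left)
  finally have total: "real (card {A :: 'f poly. degree A \<le> d}) = h * B * real CARD('f)"
    unfolding norm_\<Psi> B_def by (simp add: sum_distrib_left mult_ac)
  have pos: "form w (E a) \<psi>' \<in> \<real>\<^sub>\<ge>\<^sub>0" for a \<psi>' using povm by (simp add: povm_def)
  have bound: "Re (form w (E a) (\<Psi> v a)) \<le> real N * (\<Sum>\<gamma>\<in>?att v. Re (form w (E a) (\<Phi> v \<gamma>)))" for v a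
  proof -
    have "Re (form w (E a) (\<Psi> v a)) \<le>
        real (card (?att v)) * (\<Sum>\<gamma>\<in>?att v. Re (form w (E a) (\<lambda>i. e (\<gamma> * a) * \<Phi> v \<gamma> i)))"
      unfolding \<Psi>_def using pos by (rule form_sum_le)
    also have "\<dots> = real (card (?att v)) * (\<Sum>\<gamma>\<in>?att v. Re (form w (E a) (\<Phi> v \<gamma>)))"
      by (simp add: form_scale norm)
    also have "\<dots> \<le> real N * (\<Sum>\<gamma>\<in>?att v. Re (form w (E a) (\<Phi> v \<gamma>)))"
      unfolding N_def using card_attainable_le_max[of d q v] pos
      by (intro mult_right_mono sum_nonneg) (auto simp: complex_nonneg_Reals_iff)
    finally show ?thesis .
  qed
  have "(\<Sum>A | degree A \<le> d. outcome_prob alg A (poly A 0)) =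
      (\<Sum>A | degree A \<le> d. Re (form w (E (coeff A 0)) (\<psi> A)))"
    by (simp add: outcome_prob_def w_def E_def \<psi>_def poly_0_coeff_0)
  also have "\<dots> = (\<Sum>a\<in>UNIV. \<Sum>A\<in>?H a. Re (form w (E a) (\<psi> A)))"
    unfolding split by (intro sum.cong refl) auto
  also have "\<dots> = (\<Sum>a\<in>UNIV. h * (\<Sum>v\<in>V. Re (form w (E a) (\<Psi> v a))))"
    unfolding fibre ..
  also have "\<dots> \<le> (\<Sum>a\<in>UNIV. h * (\<Sum>v\<in>V. real N * (\<Sum>\<gamma>\<in>?att v. Re (form w (E a) (\<Phi> v \<gamma>)))))"
    using bound by (intro sum_mono mult_left_mono) (auto simp: h_def)
  also have "\<dots> = h * real N * (\<Sum>a\<in>UNIV. \<Sum>v\<in>V. \<Sum>\<gamma>\<in>?att v. Re (form w (E a) (\<Phi> v \<gamma>)))"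
    by (simp add: sum_distrib_left mult_ac)
  also have "(\<Sum>a\<in>UNIV. \<Sum>v\<in>V. \<Sum>\<gamma>\<in>?att v. Re (form w (E a) (\<Phi> v \<gamma>))) =
      (\<Sum>v\<in>V. \<Sum>a\<in>UNIV. \<Sum>\<gamma>\<in>?att v. Re (form w (E a) (\<Phi> v \<gamma>)))"
    by (rule sum.swap)
  also have "\<dots> = (\<Sum>v\<in>V. \<Sum>\<gamma>\<in>?att v. \<Sum>a\<in>UNIV. Re (form w (E a) (\<Phi> v \<gamma>)))"
    by (intro sum.cong refl sum.swap)
  also have "\<dots> = B"
    unfolding B_def sum_form_povm[OF povm, symmetric] by simp
  finally have "(\<Sum>A | degree A \<le> d. outcome_prob alg A (poly A 0)) \<le> h * real N * B" .
  then have "success_prob d alg \<le> h * real N * B / (h * B * real CARD('f))"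
    unfolding success_prob_def total[symmetric] by (intro divide_right_mono) auto
  moreover have "h * B \<noteq> 0" using total card_degree_le_pos[where 'f = 'f, of d] by auto
  ultimately show ?thesis unfolding N_def by (simp add: field_simps)
qed

end

section \<open>An optimal algorithm\<close>

lemma sum_basis:
  fixes f :: "('f::{zero,finite}) index \<Rightarrow> 'b::comm_monoid_add"
  shows "(\<Sum>i\<in>basis w. f i) = (\<Sum>x\<in>UNIV - {0}. \<Sum>y\<in>UNIV. \<Sum>z<w. f (x, y, z))"
  by (simp add: basis_def sum.cartesian_product case_prod_unfold)

definition monomial_op :: "('f index \<Rightarrow> 'f index) \<Rightarrow> ('f index \<Rightarrow> complex) \<Rightarrow> 'f operator" where
  "monomial_op f c = (\<lambda>i j. if i = f j then c j else 0)"

lemma apply_monomial_op: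
  fixes \<psi> :: "('f::{zero,finite}) state"
  assumes f: "bij_betw f (basis w) (basis w)" and j: "j \<in> basis w"
  shows "apply_op w (monomial_op f c) \<psi> (f j) = c j * \<psi> j"
proof -
  have "apply_op w (monomial_op f c) \<psi> (f j) = (\<Sum>k\<in>basis w. if k = j then c j * \<psi> j else 0)"
    unfolding apply_op_def monomial_op_def
    using f j by (intro sum.cong refl) (auto simp: bij_betw_def inj_on_def)
  then show ?thesis using j by simp
qed

lemma unitary_monomial_op:
  fixes f :: "('f::{zero,finite}) index \<Rightarrow> 'f index"
  assumes f: "bij_betw f (basis w) (basis w)" and c: "\<And>j. j \<in> basis w \<Longrightarrow> cmod (c j) = 1"
  shows "unitary_op w (monomial_op f c)"
proof -
  have c': "c j * cnj (c j) = 1" "cnj (c j) * c j = 1" if "j \<in> basis w" for j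
    using complex_norm_square[of "c j"] c[OF that] by (simp_all add: mult.commute)
  have inj: "f i = f j \<longleftrightarrow> i = j" if "i \<in> basis w" "j \<in> basis w" for i j
    using f that by (auto simp: bij_betw_def inj_on_def)
  have "(\<Sum>k\<in>basis w. cnj (monomial_op f c k i) * monomial_op f c k j) = (if i = j then 1 else 0)"
    if "i \<in> basis w" "j \<in> basis w" for i j
  proof -
    have "f i \<in> basis w" using f that(1) by (auto simp: bij_betw_def)
    have "(\<Sum>k\<in>basis w. cnj (monomial_op f c k i) * monomial_op f c k j) =
        (\<Sum>k\<in>basis w. if k = f i then (if i = j then 1 else 0) else 0)"
      using that c' inj by (intro sum.cong refl) (auto simp: monomial_op_def)
    then show ?thesis using \<open>f i \<in> basis w\<close> by simp
  qed
  moreover have "(\<Sum>k\<in>basis w. monomial_op f c i k * cnj (monomial_op f c j k)) = (if i = j then 1 else 0)"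
    if ij: "i \<in> basis w" "j \<in> basis w" for i j
  proof -
    obtain i' where i': "i' \<in> basis w" "i = f i'"
      using f ij(1) unfolding bij_betw_def by blast
    have "monomial_op f c i k * cnj (monomial_op f c j k) = (if k = i' then (if i = j then 1 else 0) else 0)"
      if k: "k \<in> basis w" for k
    proof (cases "k = i'")
      case True
      then show ?thesis using c'(1)[OF k] by (auto simp: monomial_op_def i'(2))
    next
      case False
      then have "i \<noteq> f k" using inj[OF i'(1) k] i'(2) by simp
      then show ?thesis using False by (simp add: monomial_op_def)
    qed
    then show ?thesis using i'(1) by simp
  qed
  ultimately show ?thesis unfolding unitary_op_def by blast
qed

lemma sparse_weights_query_sequence:
  fixes u :: "'f::{field,finite} \<Rightarrow> 'f"
  assumes u: "u \<in> sparse_weights q"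
  obtains X S :: "nat \<Rightarrow> 'f" where
    "\<And>t. X t \<noteq> 0" "X q = 1" "S q = 0" "\<And>F. (\<Sum>x\<in>UNIV. u x * F x) = (\<Sum>t<q. S t * F (X t))"
proof -
  let ?c = "card (supp u)"
  obtain g where g: "bij_betw g {0..<?c} (supp u)" using ex_bij_betw_nat_finite[of "supp u"] by auto
  have c: "?c \<le> q" and u0: "u 0 = 0" using u by (auto simp: sparse_weights_def)
  define X where "X t = (if t < ?c then g t else 1)" for t
  define S where "S t = (if t < ?c then u (g t) else 0)" for t
  have "g t \<noteq> 0" if "t < ?c" for t
    using bij_betwE[OF g] that u0 by (force simp: supp_def)
  then have "X t \<noteq> 0" for t by (simp add: X_def)
  moreover have "X q = 1" "S q = 0" using c by (auto simp: X_def S_def)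
  moreover have "(\<Sum>x\<in>UNIV. u x * F x) = (\<Sum>t<q. S t * F (X t))" for F
  proof -
    have "(\<Sum>x\<in>UNIV. u x * F x) = (\<Sum>x\<in>supp u. u x * F x)"
      by (intro sum.mono_neutral_right) (auto simp: supp_def)
    also have "\<dots> = (\<Sum>t\<in>{0..<?c}. u (g t) * F (g t))"
      using sum.reindex_bij_betw[OF g, of "\<lambda>x. u x * F x"] by simp
    also have "\<dots> = (\<Sum>t<q. S t * F (X t))"
      using c by (intro sum.mono_neutral_cong_left) (auto simp: X_def S_def)
    finally show ?thesis .
  qed
  ultimately show ?thesis by (rule that)
qed

definition block_projection :: "(nat \<Rightarrow> complex) \<Rightarrow> 'f operator" where
  "block_projection c = (\<lambda>(x, y, z) (x', y', z'). if x = x' \<and> y = y' then c z * cnj (c z') else 0)"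

lemma form_block_projection:
  fixes \<psi> :: "('f::{zero,finite}) state"
  shows "form w (block_projection c) \<psi> =
    of_real (\<Sum>x\<in>UNIV - {0}. \<Sum>y\<in>UNIV. (cmod (\<Sum>z<w. cnj (c z) * \<psi> (x, y, z)))\<^sup>2)"
proof -
  let ?s = "\<lambda>x y. \<Sum>z<w. cnj (c z) * \<psi> (x, y, z)"
  have ap: "apply_op w (block_projection c) \<psi> (x, y, z) = c z * ?s x y" if "x \<noteq> 0" for x y z
  proof -
    have "apply_op w (block_projection c) \<psi> (x, y, z) =
        (\<Sum>x'\<in>UNIV - {0}. \<Sum>y'\<in>UNIV. if x' = x \<and> y' = y then c z * ?s x y else 0)"
      unfolding apply_op_def sum_basis
      by (intro sum.cong refl) (auto simp: block_projection_def sum_distrib_left mult.assoc)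
    also have "\<dots> = (\<Sum>x'\<in>UNIV - {0}. if x' = x then c z * ?s x y else 0)"
      by (intro sum.cong refl) auto
    finally show ?thesis using that by simp
  qed
  have "form w (block_projection c) \<psi> =
      (\<Sum>x\<in>UNIV - {0}. \<Sum>y\<in>UNIV. \<Sum>z<w. cnj (\<psi> (x, y, z)) * (c z * ?s x y))"
    unfolding form_def sum_basis by (intro sum.cong refl) (simp add: ap)
  also have "\<dots> = (\<Sum>x\<in>UNIV - {0}. \<Sum>y\<in>UNIV. ?s x y * cnj (?s x y))"
  proof -
    have "(\<Sum>z<w. cnj (\<psi> (x, y, z)) * (c z * s)) = s * cnj (?s x y)" for x y s
      by (simp add: sum_distrib_left mult_ac)
    then show ?thesis by simp
  qed
  finally show ?thesis by (simp add: complex_norm_square del: of_real_power)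
qed

context additive_character
begin

lemma ex_query_algorithm:
  "\<exists>alg :: 'f query_algorithm. is_query_algorithm q alg \<and>
    success_prob d alg = real (max_attainable TYPE('f) d q) / real CARD('f)"
proof -
  obtain v :: "nat \<Rightarrow> 'f" where v: "card (attainable d q v) = max_attainable TYPE('f) d q"
    by (rule max_attainable_witness)
  define N where "N = card (attainable d q v)"
  define Q where "Q = real CARD('f)"
  have N: "N > 0" unfolding N_def v by (rule max_attainable_pos)
  have Q: "Q > 0" by (simp add: Q_def)
  obtain g where g: "bij_betw g {0..<N} (attainable d q v)"
    unfolding N_def using ex_bij_betw_nat_finite[of "attainable d q v"] by auto
  define P where "P z X S \<longleftrightarrow> (\<forall>t. X t \<noteq> 0) \<and> X q = 1 \<and> S q = 0 \<and> (\<forall>A. degree A \<le> d \<longrightarrow>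
      (\<Sum>t<q. S t * poly A (X t)) = g z * coeff A 0 + (\<Sum>k\<in>{1..d}. v k * coeff A k))"
    for z and X S :: "nat \<Rightarrow> 'f"
  have "\<exists>X S. P z X S"
    if "z < N" for z
  proof -
    have "g z \<in> attainable d q v" using bij_betwE[OF g] that by auto
    then obtain u where u: "g z = moment u 0" "u \<in> sparse_weights q" "\<And>k. k \<in> {1..d} \<Longrightarrow> moment u k = v k"
      unfolding attainable_def by blast
    obtain X S :: "nat \<Rightarrow> 'f" where XS: "\<And>t. X t \<noteq> 0" "X q = 1" "S q = 0"
      "\<And>F. (\<Sum>x\<in>UNIV. u x * F x) = (\<Sum>t<q. S t * F (X t))"
      using sparse_weights_query_sequence[OF u(2)] by blast
    have "(\<Sum>t<q. S t * poly A (X t)) = g z * coeff A 0 + (\<Sum>k\<in>{1..d}. v k * coeff A k)"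
      if "degree A \<le> d" for A
    proof -
      have "{..d} = insert 0 {1..d}" by auto
      then show ?thesis unfolding XS(4)[symmetric] sum_weight_poly[OF that] using u by simp
    qed
    with XS show ?thesis unfolding P_def by blast
  qed
  then obtain X S where "\<And>z. z < N \<Longrightarrow> P z (X z) (S z)" by metis
  then have X0: "\<And>z t. z < N \<Longrightarrow> X z t \<noteq> 0"
    and last: "\<And>z. z < N \<Longrightarrow> X z q = 1" "\<And>z. z < N \<Longrightarrow> S z q = 0"
    and phase: "\<And>z A. z < N \<Longrightarrow> degree A \<le> d \<Longrightarrow>
      (\<Sum>t<q. S z t * poly A (X z t)) = g z * coeff A 0 + (\<Sum>k\<in>{1..d}. v k * coeff A k)"
    unfolding P_def by blast+
  define st where "st A t = (\<lambda>(x, y, z). if x = X z t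
      then e (- (S z t * y)) * e (\<Sum>r<t. S z r * poly A (X z r)) / of_real (sqrt (N * Q)) else 0)"
    for A t
  define f where "f t = (\<lambda>(x, y, z :: nat). (x * X z (Suc t) / X z t, y :: 'f, z))" for t
  define G where "G t = monomial_op (f t) (\<lambda>(x, y, z). e (- ((S z (Suc t) - S z t) * y)))" for t
  define M :: "'f \<Rightarrow> 'f operator" where "M a = block_projection (\<lambda>z. e (g z * a) / of_real (sqrt Q))" for a
  define alg where "alg = \<lparr>workdim = N, init = st 0 0, gates = map G [0..<q], meas = M\<rparr>"
  have f: "bij_betw (f t) (basis N) (basis N)" for t
    using X0 by (intro bij_betwI[where g = "\<lambda>(x, y, z). (x * X z t / X z (Suc t), y, z)"])
      (auto simp: f_def basis_def)
  have "unit_state N (st 0 0)"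
  proof -
    have "(\<Sum>i\<in>basis N. (cmod (st 0 0 i))\<^sup>2) =
        (\<Sum>x\<in>UNIV - {0}. \<Sum>y\<in>(UNIV :: 'f set). \<Sum>z<N. if x = X z 0 then 1 / (N * Q) else 0)"
      unfolding sum_basis
      using Q by (intro sum.cong refl) (auto simp: st_def norm_divide norm power_divide)
    also have "\<dots> = Q * (\<Sum>x\<in>UNIV - {0}. \<Sum>z<N. if x = X z 0 then 1 / (N * Q) else 0)"
      by (simp add: Q_def sum_distrib_left)
    also have "(\<Sum>x\<in>UNIV - {0}. \<Sum>z<N. if x = X z 0 then 1 / (N * Q) else 0) =
        (\<Sum>z<N. \<Sum>x\<in>UNIV - {0}. if x = X z 0 then 1 / (N * Q) else 0)"
      by (rule sum.swap)
    also have "\<dots> = (\<Sum>z<N. 1 / (N * Q))"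
      using X0 by (intro sum.cong refl) simp
    finally show ?thesis using N Q by (simp add: unit_state_def)
  qed
  moreover have "\<forall>U\<in>set (map G [0..<q]). unitary_op N U"
    unfolding G_def using f by (auto intro!: unitary_monomial_op simp: norm)
  moreover have "povm N M"
    unfolding povm_def
  proof (intro conjI allI ballI)
    show "form N (M a) \<psi> \<in> \<real>\<^sub>\<ge>\<^sub>0" for a \<psi>
      unfolding M_def form_block_projection nonneg_Reals_of_real_iff by (intro sum_nonneg) auto
  next
    fix i j :: "'f index"
    assume ij: "i \<in> basis N" "j \<in> basis N"
    obtain x y z x' y' z' where i: "i = (x, y, z)" and j: "j = (x', y', z')" by (cases i, cases j) auto
    have z: "z < N" "z' < N" using ij by (auto simp: i j basis_def)
    have sq: "of_real (sqrt Q) * of_real (sqrt Q) = (of_nat CARD('f) :: complex)"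
      using Q by (simp add: Q_def flip: of_real_mult)
    have M: "M a i j = (if x = x' \<and> y = y' then e ((g z - g z') * a) / of_nat CARD('f) else 0)" for a
      unfolding sq[symmetric] by (simp add: M_def block_projection_def i j cnj left_diff_distrib flip: add)
    have "(\<Sum>a\<in>UNIV. M a i j) =
        (if x = x' \<and> y = y' then (\<Sum>a\<in>UNIV. e ((g z - g z') * a)) / of_nat CARD('f) else 0)"
    proof (cases "x = x' \<and> y = y'")
      case True
      then show ?thesis unfolding M by (simp add: sum_divide_distrib)
    next
      case False
      then show ?thesis unfolding M by (simp only: if_False sum.neutral_const)
    qed
    moreover have "g z = g z' \<longleftrightarrow> z = z'"
      using g z by (auto simp: bij_betw_def inj_on_def)
    ultimately show "(\<Sum>a\<in>UNIV. M a i j) = (if i = j then 1 else 0)"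
      by (simp add: sum_mult i j)
  qed
  ultimately have is_alg: "is_query_algorithm q alg"
    by (simp add: is_query_algorithm_def alg_def)
  have run: "foldl (\<lambda>\<psi> U. apply_op N U (apply_op N (query_op A) \<psi>)) (st 0 0) (map G [0..<t]) i = st A t i"
    if "i \<in> basis N" for A t i
    using that
  proof (induction t arbitrary: i)
    case 0
    then show ?case by (cases i) (simp add: st_def)
  next
    case (Suc t)
    define \<psi> where "\<psi> = foldl (\<lambda>\<psi> U. apply_op N U (apply_op N (query_op A) \<psi>)) (st 0 0) (map G [0..<t])"
    have IH: "\<psi> i = st A t i" if "i \<in> basis N" for i using Suc.IH that by (simp add: \<psi>_def)
    obtain j where j: "j \<in> basis N" "i = f t j"
      using f[of t] Suc.prems unfolding bij_betw_def by blast
    obtain x y z where xyz: "j = (x, y, z)" by (cases j) auto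
    have b: "x \<noteq> 0" "z < N" "(x, y - poly A x, z) \<in> basis N" using j by (auto simp: xyz basis_def)
    have "apply_op N (G t) (apply_op N (query_op A) \<psi>) i =
        e (- ((S z (Suc t) - S z t) * y)) * st A t (x, y - poly A x, z)"
      unfolding j(2) G_def apply_monomial_op[OF f j(1)]
      using j(1) b by (simp add: xyz apply_query_op IH)
    also have "\<dots> = st A (Suc t) i"
    proof (cases "x = X z t")
      case True
      let ?K = "\<Sum>r<t. S z r * poly A (X z r)" and ?c = "of_real (sqrt (N * Q)) :: complex"
      have st: "st A t (x, y - poly A x, z) = e (- (S z t * (y - poly A x))) * e ?K / ?c"
        using True by (simp add: st_def)
      have st': "st A (Suc t) i = e (- (S z (Suc t) * y)) * e (?K + S z t * poly A x) / ?c"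
        using True X0[OF b(2)] by (simp add: st_def f_def xyz j(2))
      have "- ((S z (Suc t) - S z t) * y) + (- (S z t * (y - poly A x)) + ?K) =
          - (S z (Suc t) * y) + (?K + S z t * poly A x)"
        by (simp add: algebra_simps)
      then have "e (- ((S z (Suc t) - S z t) * y)) * (e (- (S z t * (y - poly A x))) * e ?K) =
          e (- (S z (Suc t) * y)) * e (?K + S z t * poly A x)"
        by (simp only: add[symmetric])
      then show ?thesis unfolding st st' times_divide_eq_right by (rule arg_cong)
    next
      case False
      then show ?thesis using X0[OF b(2)] unfolding j(2) by (simp add: st_def f_def xyz field_simps)
    qed
    finally show ?case by (simp add: \<psi>_def)
  qed
  have "outcome_prob alg A (poly A 0) = N / Q" if A: "degree A \<le> d" for A
  proof -
    let ?a = "coeff A 0" and ?\<kappa> = "e (\<Sum>k\<in>{1..d}. v k * coeff A k)"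
    have amp: "(cmod (\<Sum>z<N. cnj (e (g z * ?a) / of_real (sqrt Q)) * st A q (x, y, z)))\<^sup>2 =
        (if x = 1 then N / Q\<^sup>2 else 0)" for x y
    proof (cases "x = 1")
      case True
      have "cnj (e (g z * ?a) / of_real (sqrt Q)) * st A q (x, y, z) =
          ?\<kappa> / of_real (sqrt Q * sqrt (N * Q))" if "z < N" for z
      proof -
        have "cnj (e (g z * ?a)) * e (g z * ?a + (\<Sum>k\<in>{1..d}. v k * coeff A k)) = ?\<kappa>"
          by (simp add: cnj flip: add)
        then show ?thesis
          using that by (simp add: st_def True last phase A)
      qed
      then have "(\<Sum>z<N. cnj (e (g z * ?a) / of_real (sqrt Q)) * st A q (x, y, z)) =
          of_nat N * (?\<kappa> / of_real (sqrt Q * sqrt (N * Q)))" by simp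
      then have "cmod (\<Sum>z<N. cnj (e (g z * ?a) / of_real (sqrt Q)) * st A q (x, y, z)) =
          N / (sqrt Q * sqrt (N * Q))"
        using Q by (simp add: norm_mult norm_divide norm)
      moreover have "(N / (sqrt Q * sqrt (N * Q)))\<^sup>2 = N\<^sup>2 / (Q * (N * Q))"
        using Q by (simp add: power_divide power_mult_distrib)
      moreover have "\<dots> = N / Q\<^sup>2"
        using N Q by (simp add: field_simps power2_eq_square)
      ultimately show ?thesis using True by simp
    next
      case False
      then show ?thesis using last by (simp add: st_def)
    qed
    have "form N (M ?a) (final_state alg A) = form N (M ?a) (st A q)"
      by (intro form_cong) (simp add: final_state_def alg_def run)
    also have "\<dots> = of_real (\<Sum>x\<in>UNIV - {0 :: 'f}. \<Sum>y\<in>(UNIV :: 'f set). if x = 1 then N / Q\<^sup>2 else 0)"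
      unfolding M_def form_block_projection amp ..
    also have "\<dots> = of_real (\<Sum>x\<in>UNIV - {0 :: 'f}. if x = 1 then N / Q else 0)"
      using Q by (intro arg_cong[of _ _ of_real] sum.cong refl) (simp add: Q_def power2_eq_square)
    also have "\<dots> = of_real (N / Q)" by simp
    finally show ?thesis by (simp add: outcome_prob_def alg_def poly_0_coeff_0)
  qed
  then have sum: "(\<Sum>A | degree A \<le> d. outcome_prob alg A (poly A 0)) =
      real (card {A :: 'f poly. degree A \<le> d}) * (N / Q)"
    by simp
  have "success_prob d alg = real (card {A :: 'f poly. degree A \<le> d}) * (N / Q) /
      real (card {A :: 'f poly. degree A \<le> d})"
    unfolding success_prob_def sum ..
  also have "\<dots> = N / Q"
  proof (rule nonzero_mult_div_cancel_left)
    show "real (card {A :: 'f poly. degree A \<le> d}) \<noteq> 0"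
      using card_degree_le_pos[where 'f = 'f, of d] by linarith
  qed
  finally have "success_prob d alg = N / Q" .
  with is_alg show ?thesis unfolding N_def Q_def v by blast
qed

end

theorem theorem8:
  fixes d q :: nat
  shows "\<exists>p. is_max_success_prob TYPE('f::{field,finite}) d q p \<and>
    (real q \<le> real d / 2 \<longrightarrow> p = 1 / real CARD('f)) \<and>
    (real q = (real d + 1) / 2 \<longrightarrow>
       (q \<le> CARD('f) - 1 \<longrightarrow>
          p \<le> of_int \<lfloor>(real CARD('f) - 1) / real q\<rfloor> / real CARD('f)) \<and>
       (q dvd CARD('f) - 1 \<longrightarrow>
          p = of_int \<lfloor>(real CARD('f) - 1) / real q\<rfloor> / real CARD('f))) \<and>
    (real q \<ge> (real d + 2) / 2 \<longrightarrow>
       p \<ge> 1 - (fact (d div 2 + 1) + real d + 1) / real CARD('f))"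
proof (intro exI conjI impI)
  let ?N = "max_attainable TYPE('f) d q" and ?Q = "real CARD('f)"
  have Q: "?Q > 0" and Q1: "real (CARD('f) - 1) = ?Q - 1"
    by (simp_all add: of_nat_diff Suc_le_eq)
  obtain e :: "'f \<Rightarrow> complex" where "additive_character e" using ex_additive_character by blast
  then interpret additive_character e .
  show "is_max_success_prob TYPE('f) d q (real ?N / ?Q)"
    unfolding is_max_success_prob_def
    by (intro conjI allI impI ex_query_algorithm success_prob_le)
  show "real ?N / ?Q = 1 / ?Q" if "real q \<le> real d / 2"
  proof -
    have "2 * q \<le> d" using that by linarith
    then show ?thesis by (simp add: max_attainable_few_queries)
  qed
  show "real ?N / ?Q \<le> of_int \<lfloor>(?Q - 1) / real q\<rfloor> / ?Q"
    if "real q = (real d + 1) / 2" "q \<le> CARD('f) - 1"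
  proof -
    have "real (2 * q) = real (d + 1)" using that(1) by simp
    then have q: "2 * q = d + 1" by (simp only: of_nat_eq_iff)
    have "real (?N * q) \<le> real (CARD('f) - 1)"
      unfolding of_nat_le_iff using q that(2) by (rule max_attainable_critical_le)
    moreover have "real q > 0" using q by simp
    ultimately have "real ?N \<le> (?Q - 1) / real q" unfolding Q1 by (simp add: field_simps)
    then have "int ?N \<le> \<lfloor>(?Q - 1) / real q\<rfloor>" by (simp add: le_floor_iff)
    then have "real ?N \<le> of_int \<lfloor>(?Q - 1) / real q\<rfloor>" by linarith
    then show ?thesis by (intro divide_right_mono) auto
  qed
  show "real ?N / ?Q = of_int \<lfloor>(?Q - 1) / real q\<rfloor> / ?Q"
    if "real q = (real d + 1) / 2" "q dvd CARD('f) - 1"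
  proof -
    have "real (2 * q) = real (d + 1)" using that(1) by simp
    then have q: "2 * q = d + 1" by (simp only: of_nat_eq_iff)
    have "real (?N * q) = real (CARD('f) - 1)"
      unfolding of_nat_eq_iff using q that(2) by (rule max_attainable_critical_eq)
    moreover have "real q > 0" using q by simp
    ultimately have "(?Q - 1) / real q = real ?N" unfolding Q1 by (simp add: field_simps)
    then show ?thesis by simp
  qed
  show "real ?N / ?Q \<ge> 1 - (fact (d div 2 + 1) + real d + 1) / ?Q"
    if "real q \<ge> (real d + 2) / 2"
  proof -
    have "real (d + 2) \<le> real (2 * q)" using that by simp
    then have "d + 2 \<le> 2 * q" by (simp only: of_nat_le_iff)
    from max_attainable_ge[OF this, where 'f = 'f]
    have "(?Q - (fact (d div 2 + 1) + real d + 1)) / ?Q \<le> real ?N / ?Q"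
      by (rule divide_right_mono) simp
    then show ?thesis using Q by (simp add: diff_divide_distrib)
  qed
qed

end
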